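(* Let $d>2$ be an integer, let $a_1,\dots,a_d>0$ be real numbers, and let $D=\prod_{i=1}^d(-a_i,a_i)\subset\mathbb{R}^d$ be a box (in particular, $D$ may be a cube). If $u$ is an eigenfunction of the Neumann Laplacian on $D$ (for any eigenvalue $\mu\ge0$) and $u\ge 0$ at every point of $\partial D$, then $u$ is constant in $D$.
   Context: A Neumann eigenfunction on $D$ is a real-valued, not identically zero function $u\in H^1(D)$ such that for some $\mu\in\mathbb{R}$ one has $\int_D\nabla u\cdot\nabla v=\mu\int_D uv$ for all $v\in H^1(D)$ (equivalently $\Delta u=-\mu u$ in $D$, $\partial_\nu u=0$ on $\partial D$). Such eigenfunctions extend continuously to $\overline D$, and boundary values refer to this extension. *)

theory Defs
  imports "HOL-Analysis.Analysis"
begin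

definition partial_deriv :: "'n::finite \<Rightarrow> (real ^ 'n \<Rightarrow> real) \<Rightarrow> real ^ 'n \<Rightarrow> real" where
  "partial_deriv i f x = frechet_derivative f (at x) (axis i 1)"

primrec C_diff :: "nat \<Rightarrow> (real ^ 'n::finite \<Rightarrow> real) \<Rightarrow> bool" where
  "C_diff 0 f \<longleftrightarrow> continuous_on UNIV f"
| "C_diff (Suc k) f \<longleftrightarrow> f differentiable_on UNIV \<and> (\<forall>i. C_diff k (partial_deriv i f))"

text \<open>Elements of $C_c^\infty(D)$, extended by zero to the whole space.\<close>

definition test_functions :: "(real ^ 'n::finite) set \<Rightarrow> (real ^ 'n \<Rightarrow> real) set" where
  "test_functions D =
     {\<phi>. (\<forall>k. C_diff k \<phi>) \<and> compact (closure {x. \<phi> x \<noteq> 0}) \<and> closure {x. \<phi> x \<noteq> 0} \<subseteq> D}"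

text \<open>
  Elements of $L^2$ and $H^1$ are represented by functions on the whole space, of which only the
  values on \<open>D\<close>, up to null sets, matter.
\<close>

definition L2_on :: "(real ^ 'n::finite) set \<Rightarrow> (real ^ 'n \<Rightarrow> real) set" where
  "L2_on D =
     {f \<in> borel_measurable (lebesgue_on D). integrable (lebesgue_on D) (\<lambda>x. (f x)\<^sup>2)}"

definition weak_gradient ::
    "(real ^ 'n::finite) set \<Rightarrow> (real ^ 'n \<Rightarrow> real) \<Rightarrow> (real ^ 'n \<Rightarrow> real ^ 'n) \<Rightarrow> bool" where
  "weak_gradient D u G \<longleftrightarrow>
     (\<forall>i. (\<lambda>x. G x $ i) \<in> L2_on D \<and>
        (\<forall>\<phi>\<in>test_functions D.
           integral\<^sup>L (lebesgue_on D) (\<lambda>x. u x * partial_deriv i \<phi> x) =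
           - integral\<^sup>L (lebesgue_on D) (\<lambda>x. G x $ i * \<phi> x)))"

definition H1_on :: "(real ^ 'n::finite) set \<Rightarrow> (real ^ 'n \<Rightarrow> real) set" where
  "H1_on D = {u \<in> L2_on D. \<exists>G. weak_gradient D u G}"

text \<open>
  The weak gradients of \<open>u\<close> and \<open>v\<close> are unique up to null sets, so it does not matter which
  representatives \<open>Gu\<close>, \<open>Gv\<close> are used.
\<close>

definition neumann_eigenfunction :: "(real ^ 'n::finite) set \<Rightarrow> (real ^ 'n \<Rightarrow> real) \<Rightarrow> bool" where
  "neumann_eigenfunction D u \<longleftrightarrow>
     u \<in> H1_on D \<and>
     \<not> (AE x in lebesgue_on D. u x = 0) \<and>
     (\<exists>\<mu>::real. \<forall>Gu. weak_gradient D u Gu \<longrightarrow>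
        (\<forall>v\<in>H1_on D. \<forall>Gv. weak_gradient D v Gv \<longrightarrow>
           integral\<^sup>L (lebesgue_on D) (\<lambda>x. Gu x \<bullet> Gv x) =
           \<mu> * integral\<^sup>L (lebesgue_on D) (\<lambda>x. u x * v x)))"

definition continuous_extension ::
    "(real ^ 'n::finite) set \<Rightarrow> (real ^ 'n \<Rightarrow> real) \<Rightarrow> (real ^ 'n \<Rightarrow> real) \<Rightarrow> bool" where
  "continuous_extension D u U \<longleftrightarrow>
     continuous_on (closure D) U \<and> (AE x in lebesgue_on D. U x = u x)"

lemma continuous_extension_unique:
  assumes "open D" "continuous_extension D u U" "continuous_extension D u V" "x \<in> closure D"
  shows "U x = V x"
proof -
  have cont: "continuous_on (closure D) (\<lambda>x. U x - V x)"
    using assms(2,3) unfolding continuous_extension_def by (intro continuous_intros) auto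
  have "AE x in lebesgue_on D. U x = u x \<and> V x = u x"
    using assms(2,3) unfolding continuous_extension_def by auto
  then have "AE x in lebesgue_on D. U x - V x = 0"
    by (rule AE_mp) (simp add: AE_I2)
  then have "AE x in lebesgue. x \<in> D \<longrightarrow> U x - V x = 0"
    using assms(1) by (subst (asm) AE_restrict_space_iff) auto
  then have negl: "negligible {x \<in> D. U x - V x \<noteq> 0}"
    by (subst negligible_iff_null_sets) (auto simp: AE_iff_null_sets eventually_ae_filter
        elim!: null_sets_completion_subset[rotated])
  have "open ((\<lambda>x. U x - V x) -` (- {0}) \<inter> D)"
    using continuous_on_subset[OF cont closure_subset] assms(1)
    by (subst (asm) continuous_on_open_vimage) auto
  then have "open {x \<in> D. U x - V x \<noteq> 0}"
    by (simp add: vimage_def Int_def conj_commute)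
  with negl have "{x \<in> D. U x - V x \<noteq> 0} = {}"
    using open_not_negligible by blast
  then have "\<And>y. y \<in> D \<Longrightarrow> U y - V y = 0" by blast
  then have "U x - V x = 0"
    using continuous_constant_on_closure[OF cont _ assms(4)] by blast
  then show ?thesis by simp
qed

text \<open>
  The continuous extension of \<open>u\<close>. For open \<open>D\<close>, its values on \<open>closure D\<close> are determined by
  \<open>continuous_extension_unique\<close> if an extension exists.
\<close>

definition extension :: "(real ^ 'n::finite) set \<Rightarrow> (real ^ 'n \<Rightarrow> real) \<Rightarrow> real ^ 'n \<Rightarrow> real" where
  "extension D u = (SOME U. continuous_extension D u U)"

end

theory Submission
  imports Defs
begin

text \<open>
  Put \<open>\<rho> = sqrt \<mu>\<close>. The functions $\prod_i \cos(\omega_i (x_i + a_i))$ with $\sin(2\omega_i a_i) = 0$ are a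
  complete orthogonal system of Neumann eigenfunctions of the box, with eigenvalues
  $|\omega|^2$. Hence \<open>u\<close> agrees almost everywhere with a finite sum
  $\sum c_\omega \prod_i \cos(\omega_i (x_i + a_i))$ over the frequencies $\omega \ge 0$ with
  $|\omega|^2 = \mu$ (\<open>eigenfunction_expansion\<close>), and this sum is its continuous extension. If
  $\mu \le 0$, only $\omega = 0$ can occur and \<open>u\<close> is constant. Let $\mu > 0$ from now on, and suppose
  that the extension is nonnegative on the boundary.

  On the face $x_d = -a_d$ the extension becomes a sum of products of cosines of the other
  coordinates, with frequency $\omega$ deprived of its component $\omega_d$. Since $|\omega|$ is
  fixed, different $\omega$ still give different products, so that the trace \<open>V\<close> on the face
  determines \<open>u\<close>. Let $b_i$ be the coefficient of the mode $\cos(\rho (x_i + a_i))$, which varies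
  along one axis only ($b_i = 0$ if $\rho$ is not a frequency of that axis). The mean of \<open>V\<close> over
  the face is $b_d$, so $b_d \ge 0$. Next, \<open>V\<close> is integrated against
  $\prod_{i \in S} (1 - \cos(\rho (x_i + a_i)))$, where \<open>S\<close> is the set of all axes $i \ne d$ for which
  $\rho$ is a frequency. Expanding this product produces a constant, the functions
  $-\cos(\rho (x_i + a_i))$, and products of at least two cosines; the latter have eigenvalue at least
  $2\mu$ and are orthogonal to \<open>V\<close>, whose frequencies satisfy $|\omega'|^2 \le \mu$. The result is
  $b_d - \frac12 \sum_{i \ne d} b_i > 0$, with strict inequality because \<open>V\<close> is nonnegative and
  not identically zero while the test function vanishes on a thin set only
  (\<open>axis_coeff_inequality\<close>). Summing over all \<open>n\<close> axes gives $B > \frac{n-1}{2} B$ for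
  $B = \sum_i b_i \ge 0$, which is absurd for $n \ge 3$ (\<open>no_nonneg_face_traces\<close>).

  The expansion has to be derived from the weak formulation, in which the gradient of \<open>u\<close> is only
  known through test functions with compact support. The key tool is
  \<open>integration_by_parts_tensor\<close>: integration by parts in direction \<open>i\<close> against a product of functions
  of one variable, provided that the factor in the variable $x_i$ vanishes at $\pm a_i$. The normal
  derivative of a Neumann mode has this property, so that \<open>u\<close> is orthogonal to every mode with
  another eigenvalue. Applied to the modes themselves, the same formula yields their orthogonality. Completeness comes from the
  Stone-Weierstrass theorem.
\<close>

section \<open>Smooth functions of one variable\<close>

primrec times_differentiable :: "nat \<Rightarrow> (real \<Rightarrow> real) \<Rightarrow> bool" where
  "times_differentiable 0 f \<longleftrightarrow> True"
| "times_differentiable (Suc n) f \<longleftrightarrow>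
     (\<exists>f'. (\<forall>x. (f has_real_derivative f' x) (at x)) \<and> times_differentiable n f')"

definition smooth :: "(real \<Rightarrow> real) \<Rightarrow> bool" where
  "smooth f \<longleftrightarrow> (\<forall>n. times_differentiable n f)"

lemma times_differentiable_SucI:
  "(\<And>x. (f has_real_derivative f' x) (at x)) \<Longrightarrow> times_differentiable n f' \<Longrightarrow>
    times_differentiable (Suc n) f"
  by auto

lemma times_differentiable_Suc_imp: "times_differentiable (Suc n) f \<Longrightarrow> times_differentiable n f"
proof (induction n arbitrary: f)
  case (Suc n)
  then show ?case by (metis times_differentiable.simps(2))
qed simp

lemma times_differentiable_add:
  "times_differentiable n f \<Longrightarrow> times_differentiable n g \<Longrightarrow> times_differentiable n (\<lambda>x. f x + g x)"
proof (induction n arbitrary: f g)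
  case (Suc n)
  then obtain f' g' where "\<And>x. (f has_real_derivative f' x) (at x)" "times_differentiable n f'"
    "\<And>x. (g has_real_derivative g' x) (at x)" "times_differentiable n g'"
    by auto
  then show ?case
    using Suc.IH[of f' g'] by (auto intro!: exI[of _ "\<lambda>x. f' x + g' x"] derivative_eq_intros)
qed simp

lemma times_differentiable_mult:
  "times_differentiable n f \<Longrightarrow> times_differentiable n g \<Longrightarrow> times_differentiable n (\<lambda>x. f x * g x)"
proof (induction n arbitrary: f g)
  case (Suc n)
  then obtain f' g' where fg: "\<And>x. (f has_real_derivative f' x) (at x)" "times_differentiable n f'"
    "\<And>x. (g has_real_derivative g' x) (at x)" "times_differentiable n g'"
    by auto
  have "times_differentiable n f" "times_differentiable n g"
    using Suc.prems times_differentiable_Suc_imp by blast+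
  then have "times_differentiable n (\<lambda>x. f x * g' x + f' x * g x)"
    using fg by (intro times_differentiable_add Suc.IH)
  moreover have "((\<lambda>x. f x * g x) has_real_derivative f x * g' x + f' x * g x) (at x)" for x
    using fg by (auto intro!: derivative_eq_intros)
  ultimately show ?case by (intro times_differentiable_SucI)
qed simp

text \<open>
  The factor \<open>c\<close> is there for the induction: the chain rule multiplies it by \<open>p\<close> at every step.
\<close>

lemma times_differentiable_affine:
  "times_differentiable n f \<Longrightarrow> times_differentiable n (\<lambda>x. c * f (p * x + q))"
proof (induction n arbitrary: f c)
  case (Suc n)
  then obtain f' where f: "\<And>x. (f has_real_derivative f' x) (at x)" "times_differentiable n f'"
    by auto
  have "times_differentiable n (\<lambda>x. (c * p) * f' (p * x + q))"
    by (rule Suc.IH[OF f(2)])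
  moreover have "((\<lambda>x. c * f (p * x + q)) has_real_derivative (c * p) * f' (p * x + q)) (at x)" for x
    by (auto intro!: derivative_eq_intros DERIV_chain2[OF f(1)])
  ultimately show ?case by (intro times_differentiable_SucI)
qed simp

lemma smooth_mult: "smooth f \<Longrightarrow> smooth g \<Longrightarrow> smooth (\<lambda>x. f x * g x)"
  by (simp add: smooth_def times_differentiable_mult)

lemma smooth_affine: "smooth f \<Longrightarrow> smooth (\<lambda>x. f (p * x + q))"
  using times_differentiable_affine[where c = 1] by (simp add: smooth_def)

lemma smooth_derivative:
  assumes "smooth f" "\<And>x. (f has_real_derivative f' x) (at x)"
  shows "smooth f'"
  unfolding smooth_def
proof
  fix n
  obtain g where "\<And>x. (f has_real_derivative g x) (at x)" "times_differentiable n g"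
    using assms(1) unfolding smooth_def by (metis times_differentiable.simps(2))
  moreover from this have "g = f'"
    using DERIV_unique assms(2) by blast
  ultimately show "times_differentiable n f'" by simp
qed

text \<open>
  The four functions in the induction form a family closed under differentiation.
\<close>

lemma smooth_sin_cos: "smooth sin \<and> smooth cos"
proof -
  have "times_differentiable n sin \<and> times_differentiable n cos \<and>
      times_differentiable n (\<lambda>x. - sin x) \<and> times_differentiable n (\<lambda>x. - cos x)" for n
  proof (induction n)
    case (Suc n)
    have "(sin has_real_derivative cos x) (at x)" "(cos has_real_derivative - sin x) (at x)"
      "((\<lambda>x. - sin x) has_real_derivative - cos x) (at x)"
      "((\<lambda>x. - cos x) has_real_derivative sin x) (at x)" for x :: real
      by (auto intro!: derivative_eq_intros)
    note this[THEN times_differentiable_SucI]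
    with Suc show ?case by simp
  qed simp
  then show ?thesis by (simp add: smooth_def)
qed

text \<open>
  The standard example of a smooth function vanishing on a half-line is the case \<open>m = 0\<close>. The
  negative powers are added because the derivatives of \<open>flat_exp m\<close> are then linear combinations
  of functions of the same kind, which makes smoothness a simple induction.
\<close>

definition flat_exp :: "nat \<Rightarrow> real \<Rightarrow> real" where
  "flat_exp m x = (if x > 0 then exp (- 1 / x) / x ^ m else 0)"

lemma flat_exp_tendsto_0: "(flat_exp m \<longlongrightarrow> 0) (at 0)"
proof -
  have "((\<lambda>x::real. inverse x ^ m / exp (inverse x)) \<longlongrightarrow> 0) (at_right 0)"
    by (rule filterlim_compose[OF tendsto_power_div_exp_0 filterlim_inverse_at_top_right])
  then have "(flat_exp m \<longlongrightarrow> 0) (at_right 0)"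
    by (rule Lim_transform_eventually)
       (auto simp: eventually_at_filter flat_exp_def exp_minus field_simps)
  moreover have "(flat_exp m \<longlongrightarrow> 0) (at_left 0)"
    by (rule Lim_transform_eventually[OF tendsto_const])
       (auto simp: eventually_at_filter flat_exp_def)
  ultimately show ?thesis by (simp add: filterlim_at_split)
qed

lemma flat_exp_has_derivative:
  "(flat_exp m has_real_derivative flat_exp (m + 2) x - m * flat_exp (m + 1) x) (at x)"
proof (cases x "0::real" rule: linorder_cases)
  case less
  have "((\<lambda>x. 0) has_real_derivative 0) (at x)" by simp
  then have "(flat_exp m has_real_derivative 0) (at x)"
    by (rule DERIV_cong_ev[THEN iffD1, rotated 3])
       (use less in \<open>auto simp: flat_exp_def intro!: eventually_mono[OF eventually_nhds_in_open[of "{..<0}"]]\<close>)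
  then show ?thesis using less by (simp add: flat_exp_def)
next
  case equal
  have "((\<lambda>h. flat_exp m h / h) \<longlongrightarrow> 0) (at 0)"
    by (rule Lim_transform_eventually[OF flat_exp_tendsto_0[of "Suc m"]])
       (auto simp: eventually_at_filter flat_exp_def field_simps)
  then show ?thesis using equal
    by (simp add: DERIV_def flat_exp_def)
next
  case greater
  have "((\<lambda>x. exp (- 1 / x) / x ^ m) has_real_derivative
      flat_exp (m + 2) x - m * flat_exp (m + 1) x) (at x)"
    using greater
    by (cases "m = 0 \<or> m = 1")
       (auto intro!: derivative_eq_intros
         simp: flat_exp_def field_simps power2_eq_square power_eq_if[of x m] power_eq_if[of x "m - 1"])
  then show ?thesis
    by (rule DERIV_cong_ev[THEN iffD1, rotated 3])
       (use greater in \<open>auto simp: flat_exp_def intro!: eventually_mono[OF eventually_nhds_in_open[of "{0<..}"]]\<close>)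
qed

lemma smooth_flat_exp: "smooth (flat_exp m)"
proof -
  have "times_differentiable n (flat_exp m)" for n
  proof (induction n arbitrary: m)
    case (Suc n)
    have "times_differentiable n (\<lambda>x. flat_exp (m + 2) x + (- real m) * flat_exp (m + 1) (1 * x + 0))"
      by (intro times_differentiable_add times_differentiable_affine Suc.IH)
    then show ?case
      using flat_exp_has_derivative[of m] by (intro times_differentiable_SucI) simp_all
  qed simp
  then show ?thesis by (simp add: smooth_def)
qed

section \<open>Products of functions of the separate coordinates\<close>

definition tensor :: "('n \<Rightarrow> real \<Rightarrow> real) \<Rightarrow> real ^ 'n::finite \<Rightarrow> real" where
  "tensor h x = (\<Prod>i\<in>UNIV. h i (x $ i))"

lemma tensor_has_derivative:
  assumes "\<And>i. (h i has_real_derivative h' i) (at (x $ i))"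
  shows "(tensor h has_derivative (\<lambda>v. \<Sum>i\<in>UNIV. (h' i * v $ i) * (\<Prod>j\<in>UNIV - {i}. h j (x $ j)))) (at x)"
  unfolding tensor_def
proof (rule has_derivative_prod)
  fix i
  have "(h i has_derivative (*) (h' i)) (at (x $ i))"
    using assms has_field_derivative_def by blast
  from has_derivative_compose[OF bounded_linear_imp_has_derivative[OF bounded_linear_vec_nth] this]
  show "((\<lambda>x. h i (x $ i)) has_derivative (\<lambda>v. h' i * v $ i)) (at x)" .
qed

lemma tensor_update:
  "tensor (h(i := g)) x = g (x $ i) * (\<Prod>j\<in>UNIV - {i}. h j (x $ j))"
  unfolding tensor_def by (subst prod.remove[of _ i]) auto

lemma partial_deriv_tensor:
  assumes "\<And>i. (h i has_real_derivative h' i) (at (x $ i))"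
  shows "partial_deriv i (tensor h) x = h' i * (\<Prod>j\<in>UNIV - {i}. h j (x $ j))"
proof -
  have "(\<Sum>j\<in>UNIV. (h' j * axis i 1 $ j) * (\<Prod>k\<in>UNIV - {j}. h k (x $ k))) =
      (\<Sum>j\<in>UNIV. if i = j then h' j * (\<Prod>k\<in>UNIV - {j}. h k (x $ k)) else 0)"
    by (rule sum.cong) (auto simp: axis_def)
  then show ?thesis
    unfolding partial_deriv_def frechet_derivative_at[OF tensor_has_derivative[OF assms], symmetric]
    by simp
qed

lemma smooth_has_derivative:
  "smooth f \<Longrightarrow> \<exists>f'. \<forall>x. (f has_real_derivative f' x) (at x)"
  unfolding smooth_def by (metis times_differentiable.simps(2))

lemma smooth_family_has_derivative:
  assumes "\<And>i. smooth (h i)"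
  shows "\<exists>h'. \<forall>i x. (h i has_real_derivative h' i x) (at x)"
  using choice[of "\<lambda>i h'. \<forall>x. (h i has_real_derivative h' x) (at x)"] assms smooth_has_derivative
  by blast

text \<open>
  A partial derivative of a product of this kind is another one, with one factor replaced by its
  derivative; this carries the induction.
\<close>

lemma C_diff_tensor:
  fixes h :: "'n::finite \<Rightarrow> real \<Rightarrow> real"
  assumes "\<And>i. smooth (h i)"
  shows "C_diff k (tensor h)"
  using assms
proof (induction k arbitrary: h)
  case (0 h)
  obtain h' where h': "\<forall>i x. (h i has_real_derivative h' i x) (at x)"
    using smooth_family_has_derivative[of h, OF 0] by blast
  have "tensor h differentiable_on UNIV"
    using tensor_has_derivative[of h "\<lambda>i. h' i (x $ i)" x for x, OF h'[rule_format]]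
    unfolding differentiable_on_def differentiable_def by auto
  then show ?case by (simp add: differentiable_imp_continuous_on)
next
  case (Suc k h)
  obtain h' where h': "\<forall>i x. (h i has_real_derivative h' i x) (at x)"
    using smooth_family_has_derivative[of h, OF Suc.prems] by blast
  have "tensor h differentiable_on UNIV"
    using tensor_has_derivative[of h "\<lambda>i. h' i (x $ i)" x for x, OF h'[rule_format]]
    unfolding differentiable_on_def differentiable_def by auto
  moreover have "C_diff k (partial_deriv i (tensor h))" for i
  proof -
    have "partial_deriv i (tensor h) = tensor (h(i := h' i))"
      unfolding tensor_update by (rule ext, rule partial_deriv_tensor) (rule h'[rule_format])
    moreover have "smooth ((h(i := h' i)) j)" for j
      using Suc.prems smooth_derivative[of "h i" "h' i"] h' by auto
    ultimately show ?thesis using Suc.IH by simp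
  qed
  ultimately show ?case by simp
qed

section \<open>The integral of a partial derivative\<close>

lemma partial_deriv_eq_0_if_vanishing:
  assumes "open S" "x \<in> S" "\<And>y. y \<in> S \<Longrightarrow> f y = 0"
  shows "partial_deriv i f x = 0"
proof -
  have "(f has_derivative (\<lambda>_. 0)) (at x)"
    by (rule has_derivative_transform_within_open[of "\<lambda>_. 0"]) (use assms in auto)
  then show ?thesis
    unfolding partial_deriv_def by (simp add: frechet_derivative_at[symmetric])
qed

lemma partial_deriv_mult:
  fixes f g :: "real ^ 'n::finite \<Rightarrow> real"
  assumes "f differentiable at x" "g differentiable at x"
  shows "partial_deriv i (\<lambda>x. f x * g x) x = f x * partial_deriv i g x + partial_deriv i f x * g x"
proof -
  have "((\<lambda>x. f x * g x) has_derivative (\<lambda>h. f x * frechet_derivative g (at x) h +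
      frechet_derivative f (at x) h * g x)) (at x)"
    using assms by (intro has_derivative_mult) (simp_all add: frechet_derivative_works)
  from frechet_derivative_at[OF this, symmetric] show ?thesis
    unfolding partial_deriv_def by simp
qed

lemma integrable_compact_support:
  fixes f :: "real ^ 'n::finite \<Rightarrow> real"
  assumes "f \<in> borel_measurable borel" "\<And>x. \<bar>f x\<bar> \<le> B" "\<And>x. x \<notin> cball 0 R \<Longrightarrow> f x = 0"
  shows "integrable lborel f"
proof (rule Bochner_Integration.integrable_bound)
  show "integrable lborel (\<lambda>x. B * indicator (cball (0 :: real ^ 'n) R) x)"
    using emeasure_bounded_finite[of "cball (0 :: real ^ 'n) R"]
    by (intro integrable_mult_right) (simp add: integrable_indicator_iff)
  show "AE x in lborel. norm (f x) \<le> norm (B * indicator (cball 0 R) x :: real)"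
    using assms(2,3) by (auto simp: indicator_def intro: order_trans[OF _ abs_ge_self])
qed (use assms in simp)

text \<open>
  The difference quotients of \<open>f\<close> in direction \<open>i\<close> have integral zero, because Lebesgue measure is
  invariant under translations. By the mean value theorem they are bounded by the supremum of
  the derivative, and they vanish outside a fixed ball, so dominated convergence applies.
\<close>

lemma integral_partial_deriv_eq_0:
  fixes f :: "real ^ 'n::finite \<Rightarrow> real"
  assumes diff: "f differentiable_on UNIV" and cont: "continuous_on UNIV (partial_deriv i f)"
    and supp: "bounded {x. f x \<noteq> 0}"
  shows "integral\<^sup>L lborel (partial_deriv i f) = 0"
proof -
  define g where "g = partial_deriv i f"
  define e :: "real ^ 'n" where "e = axis i 1"
  have e: "norm e = 1" by (simp add: e_def)
  obtain R where R: "\<And>x. f x \<noteq> 0 \<Longrightarrow> x \<in> cball 0 R"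
    using supp by (auto simp: bounded_iff)
  have g_out: "g x = 0" if "x \<notin> cball 0 R" for x
    unfolding g_def by (rule partial_deriv_eq_0_if_vanishing[of "- cball 0 R"]) (use R that in auto)
  have cont_g: "continuous_on UNIV g" using cont by (simp add: g_def)
  have cont_f: "continuous_on UNIV f" using diff by (rule differentiable_imp_continuous_on)
  have bounded: "\<exists>B. \<forall>x. \<bar>h x\<bar> \<le> B"
    if "continuous_on UNIV h" "\<And>x. x \<notin> cball 0 R \<Longrightarrow> h x = 0" for h :: "real ^ 'n \<Rightarrow> real"
  proof -
    have "compact (h ` cball 0 R)"
      using that(1) by (intro compact_continuous_image continuous_on_subset[OF that(1)]) auto
    then obtain B where "\<forall>x\<in>cball 0 R. \<bar>h x\<bar> \<le> B"
      by (auto dest!: compact_imp_bounded simp: bounded_iff)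
    then have "\<forall>x. \<bar>h x\<bar> \<le> max B 0"
      using that(2) by (metis abs_zero max.cobounded2 max.coboundedI1)
    then show ?thesis ..
  qed
  obtain B where B: "\<And>x. \<bar>g x\<bar> \<le> B" using bounded[OF cont_g g_out] by auto
  obtain B' where B': "\<And>x. \<bar>f x\<bar> \<le> B'" using bounded[OF cont_f] R by blast
  have line: "((\<lambda>t. f (x + t *\<^sub>R e)) has_real_derivative g (x + t *\<^sub>R e)) (at t)" for x t
  proof -
    have f: "(f has_derivative frechet_derivative f (at (x + t *\<^sub>R e))) (at (x + t *\<^sub>R e))"
      using diff by (simp add: differentiable_on_def frechet_derivative_works)
    have "((\<lambda>t. x + t *\<^sub>R e) has_derivative (\<lambda>s. s *\<^sub>R e)) (at t)"
      by (auto intro!: derivative_eq_intros)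
    from has_derivative_compose[OF this f]
    have "((\<lambda>t. f (x + t *\<^sub>R e)) has_derivative
        (\<lambda>s. frechet_derivative f (at (x + t *\<^sub>R e)) (s *\<^sub>R e))) (at t)" .
    moreover have "(\<lambda>s. frechet_derivative f (at (x + t *\<^sub>R e)) (s *\<^sub>R e)) = (*) (g (x + t *\<^sub>R e))"
      using linear_frechet_derivative[of f "at (x + t *\<^sub>R e)"] diff
      by (auto simp: g_def partial_deriv_def e_def differentiable_on_def linear_cmul)
    ultimately show ?thesis by (simp add: has_field_derivative_def)
  qed
  define q where "q n x = real (Suc n) * (f (x + inverse (real (Suc n)) *\<^sub>R e) - f x)" for n x
  have int_f: "integrable lborel f"
    by (rule integrable_compact_support[OF _ B'])
       (use R cont_f in \<open>auto intro: borel_measurable_continuous_onI\<close>)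
  have int_q: "integral\<^sup>L lborel (q n) = 0" for n
  proof -
    define c where "c = inverse (real (Suc n)) *\<^sub>R e"
    have meas: "f \<in> borel_measurable borel" using cont_f by (rule borel_measurable_continuous_onI)
    have "integrable (distr lborel borel ((+) c)) f"
      using int_f by (simp add: lborel_distr_plus)
    then have "integrable lborel (\<lambda>x. f (c + x))"
      by (subst (asm) integrable_distr_eq) (use meas in auto)
    moreover have "integral\<^sup>L lborel (\<lambda>x. f (c + x)) = integral\<^sup>L lborel f"
      using meas by (subst (2) lborel_distr_plus[of c, symmetric]) (simp add: integral_distr)
    ultimately show ?thesis
      using int_f unfolding q_def c_def[symmetric] by (simp add: add.commute)
  qed
  have "(\<lambda>n. integral\<^sup>L lborel (q n)) \<longlonglongrightarrow> integral\<^sup>L lborel g"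
  proof (rule integral_dominated_convergence[where w = "\<lambda>x. B * indicator (cball 0 (R + 1)) x"])
    show "g \<in> borel_measurable lborel"
      using borel_measurable_continuous_onI[OF cont_g] by simp
    show "q n \<in> borel_measurable lborel" for n
    proof -
      have "continuous_on UNIV (q n)"
        unfolding q_def by (intro continuous_intros cont_f continuous_on_compose2[OF cont_f]) auto
      then show ?thesis using borel_measurable_continuous_onI by simp
    qed
    show "integrable lborel (\<lambda>x. B * indicator (cball (0 :: real ^ 'n) (R + 1)) x)"
      using emeasure_bounded_finite[of "cball (0 :: real ^ 'n) (R + 1)"]
      by (intro integrable_mult_right) (simp add: integrable_indicator_iff)
    show "AE x in lborel. (\<lambda>n. q n x) \<longlonglongrightarrow> g x"
    proof (rule AE_I2)
      fix x
      have "(\<lambda>h. (f (x + (0 + h) *\<^sub>R e) - f (x + 0 *\<^sub>R e)) / h) \<midarrow>0\<rightarrow> g (x + 0 *\<^sub>R e)"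
        using line[of x 0] unfolding DERIV_def .
      then have lim: "(\<lambda>h. (f (x + h *\<^sub>R e) - f x) / h) \<midarrow>0\<rightarrow> g x" by simp
      have "filterlim (\<lambda>n. inverse (real (Suc n))) (at 0) sequentially"
        using LIMSEQ_inverse_real_of_nat by (auto simp: filterlim_at)
      from filterlim_compose[OF lim this] show "(\<lambda>n. q n x) \<longlonglongrightarrow> g x"
        by (simp add: q_def field_simps)
    qed
    show "AE x in lborel. norm (q n x) \<le> B * indicator (cball 0 (R + 1)) x" for n
    proof (rule AE_I2)
      fix x :: "real ^ 'n"
      define s where "s = inverse (real (Suc n))"
      have s: "s > 0" "s \<le> 1" by (auto simp: s_def field_simps)
      show "norm (q n x) \<le> B * indicator (cball 0 (R + 1)) x"
      proof (cases "x \<in> cball 0 (R + 1)")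
        case True
        obtain z where "f (x + s *\<^sub>R e) - f (x + 0 *\<^sub>R e) = (s - 0) * g (x + z *\<^sub>R e)"
          using MVT2[OF s(1), of "\<lambda>t. f (x + t *\<^sub>R e)" "\<lambda>t. g (x + t *\<^sub>R e)"] line by blast
        then have "q n x = g (x + z *\<^sub>R e)"
          unfolding q_def s_def[symmetric] by (simp add: s_def)
        then show ?thesis using B True by simp
      next
        case False
        have "norm x \<le> norm (x + s *\<^sub>R e) + norm (s *\<^sub>R e)"
          using norm_triangle_ineq4[of "x + s *\<^sub>R e" "s *\<^sub>R e"] by simp
        then have "norm (x + s *\<^sub>R e) > R" "norm x > R" using False s e by auto
        then have "q n x = 0" using R[of x] R[of "x + s *\<^sub>R e"] unfolding q_def s_def[symmetric] by force
        then show ?thesis using False by simp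
      qed
    qed
  qed
  then show ?thesis by (simp add: int_q g_def LIMSEQ_const_iff)
qed

section \<open>Function spaces on a box\<close>

locale neumann_box =
  fixes a :: "real ^ 'n::finite"
  assumes a_pos: "a $ i > 0"
begin

abbreviation D :: "(real ^ 'n) set" where "D \<equiv> box (- a) a"

lemma mem_D: "x \<in> D \<longleftrightarrow> (\<forall>i. - a $ i < x $ i \<and> x $ i < a $ i)"
  by (simp add: mem_box_cart)

lemma closure_D: "closure D = cbox (- a) a"
proof (rule closure_box)
  have "0 \<in> D" using a_pos by (simp add: mem_D)
  then show "D \<noteq> {}" by blast
qed

sublocale finite_measure "lebesgue_on D"
  by (rule finite_measure_lebesgue_on) simp

lemma measurable_continuous:
  "continuous_on UNIV f \<Longrightarrow> f \<in> borel_measurable (lebesgue_on D)"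
  for f :: "real ^ 'n \<Rightarrow> real"
  by (rule continuous_imp_measurable_on_sets_lebesgue) (auto intro: continuous_on_subset)

lemma continuous_bounded_on_D:
  fixes f :: "real ^ 'n \<Rightarrow> real"
  assumes "continuous_on UNIV f"
  shows "\<exists>B. \<forall>x\<in>D. \<bar>f x\<bar> \<le> B"
proof -
  have "compact (f ` cbox (- a) a)"
    by (intro compact_continuous_image continuous_on_subset[OF assms]) auto
  then show ?thesis
    using box_subset_cbox[of "- a" a] by (force dest!: compact_imp_bounded simp: bounded_iff)
qed

lemma integrable_mult_bounded:
  fixes w f :: "real ^ 'n \<Rightarrow> real"
  assumes "integrable (lebesgue_on D) w" "f \<in> borel_measurable (lebesgue_on D)"
    and "\<And>x. x \<in> D \<Longrightarrow> \<bar>f x\<bar> \<le> B"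
  shows "integrable (lebesgue_on D) (\<lambda>x. w x * f x)"
proof (rule Bochner_Integration.integrable_bound)
  show "integrable (lebesgue_on D) (\<lambda>x. B * w x)" using assms(1) by simp
  show "AE x in lebesgue_on D. norm (w x * f x) \<le> norm (B * w x)"
  proof (rule AE_I2)
    fix x assume "x \<in> space (lebesgue_on D)"
    then have "\<bar>f x\<bar> \<le> \<bar>B\<bar>" using assms(3)[of x] by auto
    then show "norm (w x * f x) \<le> norm (B * w x)"
      by (simp add: abs_mult mult.commute mult_right_mono)
  qed
qed (use assms in measurable)

lemma integrable_mult_continuous:
  fixes w f :: "real ^ 'n \<Rightarrow> real"
  assumes "integrable (lebesgue_on D) w" "continuous_on UNIV f"
  shows "integrable (lebesgue_on D) (\<lambda>x. w x * f x)"
  using continuous_bounded_on_D[OF assms(2)] measurable_continuous[OF assms(2)]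
    integrable_mult_bounded[OF assms(1)] by blast

lemma integrable_continuous:
  fixes f :: "real ^ 'n \<Rightarrow> real"
  assumes "continuous_on UNIV f"
  shows "integrable (lebesgue_on D) f"
  using integrable_mult_continuous[of "\<lambda>_. 1", OF _ assms] by simp

lemma continuous_in_L2:
  fixes f :: "real ^ 'n \<Rightarrow> real"
  assumes "continuous_on UNIV f"
  shows "f \<in> L2_on D"
  unfolding L2_on_def using assms
  by (auto intro!: measurable_continuous integrable_continuous continuous_intros)

lemma L2_integrable:
  assumes "w \<in> L2_on D"
  shows "integrable (lebesgue_on D) w"
proof (rule Bochner_Integration.integrable_bound)
  show "integrable (lebesgue_on D) (\<lambda>x. 1 + (w x)\<^sup>2)"
    using assms by (auto simp: L2_on_def)
  have "\<bar>t\<bar> \<le> 1 + t\<^sup>2" for t :: real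
    using zero_le_power2[of "\<bar>t\<bar> - 1"] by (simp add: power2_diff)
  then show "AE x in lebesgue_on D. norm (w x) \<le> norm (1 + (w x)\<^sup>2)"
    by (simp add: add_nonneg_nonneg)
qed (use assms in \<open>simp add: L2_on_def\<close>)

lemma integral_D_eq_lborel:
  fixes f :: "real ^ 'n \<Rightarrow> real"
  assumes "continuous_on UNIV f" "\<And>x. x \<notin> D \<Longrightarrow> f x = 0"
  shows "integral\<^sup>L (lebesgue_on D) f = integral\<^sup>L lborel f"
proof -
  have "(\<lambda>x. indicator D x *\<^sub>R f x) = f"
    using assms(2) by (auto simp: indicator_def fun_eq_iff)
  moreover have "f \<in> borel_measurable lborel"
    using borel_measurable_continuous_onI[OF assms(1)] by simp
  ultimately show ?thesis
    by (simp add: integral_restrict_space integral_completion)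
qed

lemma test_function_vanishing:
  assumes "\<phi> \<in> test_functions D" "x \<notin> D"
  shows "\<phi> x = 0" "partial_deriv i \<phi> x = 0"
proof -
  have x: "x \<in> - closure {x. \<phi> x \<noteq> 0}"
    using assms by (auto simp: test_functions_def)
  then show "\<phi> x = 0" using closure_subset[of "{x. \<phi> x \<noteq> 0}"] by auto
  show "partial_deriv i \<phi> x = 0"
    by (rule partial_deriv_eq_0_if_vanishing[OF _ x])
       (use closure_subset[of "{x. \<phi> x \<noteq> 0}"] in auto)
qed

text \<open>
  For a test function \<open>\<phi>\<close> the product \<open>f \<phi>\<close> has compact support in the box, so the integral of
  its partial derivatives vanishes.
\<close>

lemma weak_gradient_classical:
  fixes f :: "real ^ 'n \<Rightarrow> real"
  assumes "C_diff 1 f"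
  shows "weak_gradient D f (\<lambda>x. \<chi> i. partial_deriv i f x)"
  unfolding weak_gradient_def
proof (intro allI conjI ballI)
  fix i \<phi>
  have f: "f differentiable_on UNIV" "continuous_on UNIV f" "continuous_on UNIV (partial_deriv i f)"
    using assms by (auto intro: differentiable_imp_continuous_on)
  then show "(\<lambda>x. (\<chi> i. partial_deriv i f x) $ i) \<in> L2_on D"
    by (simp add: continuous_in_L2)
  assume \<phi>: "\<phi> \<in> test_functions D"
  have "C_diff 1 \<phi>" using \<phi> unfolding test_functions_def by blast
  then have d\<phi>: "\<phi> differentiable_on UNIV" "continuous_on UNIV \<phi>" "continuous_on UNIV (partial_deriv i \<phi>)"
    by (auto intro: differentiable_imp_continuous_on)
  let ?p = "\<lambda>x. f x * \<phi> x"
  have p': "partial_deriv i ?p = (\<lambda>x. f x * partial_deriv i \<phi> x + partial_deriv i f x * \<phi> x)"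
    using f(1) d\<phi>(1) by (intro ext partial_deriv_mult) (auto simp: differentiable_on_def)
  have cont: "continuous_on UNIV (partial_deriv i ?p)"
    unfolding p' by (intro continuous_intros f d\<phi>)
  have "{x. ?p x \<noteq> 0} \<subseteq> D"
    using test_function_vanishing(1)[OF \<phi>] by fastforce
  then have "bounded {x. ?p x \<noteq> 0}"
    using bounded_box bounded_subset by blast
  then have "integral\<^sup>L lborel (partial_deriv i ?p) = 0"
    using f(1) d\<phi>(1) cont
    by (intro integral_partial_deriv_eq_0) (auto simp: differentiable_on_def)
  also have "integral\<^sup>L lborel (partial_deriv i ?p) = integral\<^sup>L (lebesgue_on D) (partial_deriv i ?p)"
    using cont test_function_vanishing[OF \<phi>]
    by (intro integral_D_eq_lborel[symmetric]) (auto simp: p')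
  also have "\<dots> = integral\<^sup>L (lebesgue_on D) (\<lambda>x. f x * partial_deriv i \<phi> x) +
      integral\<^sup>L (lebesgue_on D) (\<lambda>x. partial_deriv i f x * \<phi> x)"
    unfolding p' by (intro Bochner_Integration.integral_add integrable_continuous continuous_intros f d\<phi>)
  finally show "integral\<^sup>L (lebesgue_on D) (\<lambda>x. f x * partial_deriv i \<phi> x) =
      - integral\<^sup>L (lebesgue_on D) (\<lambda>x. (\<chi> i. partial_deriv i f x) $ i * \<phi> x)"
    by simp
qed

end

section \<open>Integration by parts up to the boundary\<close>

text \<open>
  These functions converge to \<open>1\<close> in the open interval from \<open>-\<alpha>\<close> to \<open>\<alpha>\<close> and vanish at distance less
  than \<open>1/n\<close> from its ends, on account of the shift by \<open>1\<close>.
\<close>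

definition cutoff :: "real \<Rightarrow> nat \<Rightarrow> real \<Rightarrow> real" where
  "cutoff \<alpha> n t = flat_exp 0 (real n * (t + \<alpha>) - 1) * flat_exp 0 (real n * (\<alpha> - t) - 1)"

definition cutoff_deriv :: "real \<Rightarrow> nat \<Rightarrow> real \<Rightarrow> real" where
  "cutoff_deriv \<alpha> n t =
     real n * flat_exp 2 (real n * (t + \<alpha>) - 1) * flat_exp 0 (real n * (\<alpha> - t) - 1) -
     real n * flat_exp 0 (real n * (t + \<alpha>) - 1) * flat_exp 2 (real n * (\<alpha> - t) - 1)"

lemma flat_exp_0_bounds: "0 \<le> flat_exp 0 x" "flat_exp 0 x \<le> 1"
  by (auto simp: flat_exp_def)

lemma flat_exp_nonneg: "0 \<le> flat_exp m x"
  by (auto simp: flat_exp_def)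

lemma cutoff_bounds: "0 \<le> cutoff \<alpha> n t" "cutoff \<alpha> n t \<le> 1"
  using flat_exp_0_bounds by (auto simp: cutoff_def mult_le_one)

lemma smooth_cutoff: "smooth (cutoff \<alpha> n)"
proof -
  have "smooth (\<lambda>t. flat_exp 0 (real n * t + (real n * \<alpha> - 1)) *
      flat_exp 0 (- real n * t + (real n * \<alpha> - 1)))"
    by (intro smooth_mult smooth_affine smooth_flat_exp)
  then show ?thesis unfolding cutoff_def[abs_def] by (simp add: algebra_simps)
qed

lemma cutoff_has_derivative: "(cutoff \<alpha> n has_real_derivative cutoff_deriv \<alpha> n t) (at t)"
  unfolding cutoff_def[abs_def] cutoff_deriv_def
  by (rule derivative_eq_intros DERIV_chain2[OF flat_exp_has_derivative] refl)+
     (simp add: eval_nat_numeral)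

lemma cutoff_support: "cutoff \<alpha> n t \<noteq> 0 \<Longrightarrow> real n * (t + \<alpha>) \<ge> 1 \<and> real n * (\<alpha> - t) \<ge> 1"
  by (auto simp: cutoff_def flat_exp_def split: if_splits)

lemma affine_at_top: "c > 0 \<Longrightarrow> filterlim (\<lambda>n. real n * c - 1) at_top sequentially"
  using filterlim_tendsto_add_at_top[OF tendsto_const[of "-1"]
    filterlim_tendsto_pos_mult_at_top[OF tendsto_const _ filterlim_real_sequentially, of c]]
  by (simp add: mult.commute)

lemma cutoff_tendsto_1:
  assumes "- \<alpha> < t" "t < \<alpha>"
  shows "(\<lambda>n. cutoff \<alpha> n t) \<longlonglongrightarrow> 1"
proof -
  have "((\<lambda>x::real. exp (- inverse x)) \<longlongrightarrow> exp (- 0)) at_top"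
    by (intro tendsto_intros tendsto_inverse_0_at_top filterlim_ident)
  then have lim: "(flat_exp 0 \<longlongrightarrow> 1) at_top"
    by (simp, elim Lim_transform_eventually)
       (auto simp: flat_exp_def divide_inverse intro!: eventually_mono[OF eventually_gt_at_top[of 0]])
  have "(\<lambda>n. cutoff \<alpha> n t) \<longlonglongrightarrow> 1 * 1"
    unfolding cutoff_def
    using assms by (intro tendsto_mult filterlim_compose[OF lim] affine_at_top) auto
  then show ?thesis by simp
qed

text \<open>
  The derivative of a cutoff is of size \<open>n\<close> near the ends of the interval. This function is what
  remains of it after multiplication by the distance \<open>(y + 1) / n\<close> to an end, expressed in
  the rescaled coordinate \<open>y\<close>: it is bounded and tends to \<open>0\<close> away from the end.
\<close>

definition edge_weight :: "real \<Rightarrow> real" where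
  "edge_weight y = (y + 1) * flat_exp 2 y"

lemma edge_weight_bounds: "0 \<le> edge_weight y" "edge_weight y \<le> 3"
proof -
  show "0 \<le> edge_weight y" by (auto simp: edge_weight_def flat_exp_def)
  show "edge_weight y \<le> 3"
  proof (cases "y > 0")
    case True
    define s where "s = 1 / y"
    have "s > 0" using True by (simp add: s_def)
    then have "1 + s + s\<^sup>2 / 2 \<le> exp s" by (intro exp_lower_Taylor_quadratic) simp
    then have "s + s\<^sup>2 \<le> 3 * exp s" using \<open>s > 0\<close> by (smt (verit) zero_le_power2 field_sum_of_halves)
    then have "(s + s\<^sup>2) * exp (- s) \<le> 3" by (simp add: exp_minus field_simps)
    moreover have "edge_weight y = (s + s\<^sup>2) * exp (- s)"
      using True by (simp add: edge_weight_def flat_exp_def s_def field_simps power2_eq_square)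
    ultimately show ?thesis by simp
  qed (simp add: edge_weight_def flat_exp_def)
qed

lemma edge_weight_tendsto_0: "(edge_weight \<longlongrightarrow> 0) at_top"
proof (rule tendsto_sandwich[OF _ _ tendsto_const])
  have "((\<lambda>y::real. inverse y + inverse y * inverse y) \<longlongrightarrow> 0 + 0 * 0) at_top"
    by (intro tendsto_intros tendsto_inverse_0_at_top filterlim_ident)
  then show "((\<lambda>y::real. inverse y + inverse y * inverse y) \<longlongrightarrow> 0) at_top" by simp
  show "\<forall>\<^sub>F y in at_top. edge_weight y \<le> inverse y + inverse y * inverse y"
  proof (rule eventually_mono[OF eventually_gt_at_top[of 0]])
    fix y :: real assume "y > 0"
    then have "edge_weight y = (inverse y + inverse y * inverse y) * exp (- 1 / y)"
      by (simp add: edge_weight_def flat_exp_def field_simps power2_eq_square)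
    also have "\<dots> \<le> (inverse y + inverse y * inverse y) * 1"
      using \<open>y > 0\<close> by (intro mult_left_mono) auto
    finally show "edge_weight y \<le> inverse y + inverse y * inverse y" by simp
  qed
qed (use edge_weight_bounds in auto)

text \<open>
  A value \<open>\<psi>\<close> bounded by the distance to either end compensates the growth of the cutoff derivative.
\<close>

lemma abs_cutoff_deriv_le:
  assumes "- \<alpha> < t" "t < \<alpha>" "\<bar>\<psi>\<bar> \<le> C * (t + \<alpha>)" "\<bar>\<psi>\<bar> \<le> C * (\<alpha> - t)"
  shows "\<bar>\<psi> * cutoff_deriv \<alpha> n t\<bar> \<le>
    C * (edge_weight (real n * (t + \<alpha>) - 1) + edge_weight (real n * (\<alpha> - t) - 1))"
proof -
  define y1 where "y1 = real n * (t + \<alpha>) - 1"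
  define y2 where "y2 = real n * (\<alpha> - t) - 1"
  have "\<bar>cutoff_deriv \<alpha> n t\<bar> \<le> real n * flat_exp 2 y1 * flat_exp 0 y2 + real n * flat_exp 0 y1 * flat_exp 2 y2"
    unfolding cutoff_deriv_def y1_def[symmetric] y2_def[symmetric]
    using flat_exp_nonneg by (intro order_trans[OF abs_triangle_ineq4]) (simp add: abs_mult)
  also have "\<dots> \<le> real n * flat_exp 2 y1 * 1 + real n * 1 * flat_exp 2 y2"
    using flat_exp_nonneg flat_exp_0_bounds
    by (intro add_mono mult_left_mono mult_right_mono) auto
  finally have "\<bar>\<psi> * cutoff_deriv \<alpha> n t\<bar> \<le> \<bar>\<psi>\<bar> * (real n * flat_exp 2 y1) + \<bar>\<psi>\<bar> * (real n * flat_exp 2 y2)"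
    by (simp add: abs_mult mult_left_mono flip: distrib_left)
  also have "\<dots> \<le> C * (t + \<alpha>) * (real n * flat_exp 2 y1) + C * (\<alpha> - t) * (real n * flat_exp 2 y2)"
    using assms flat_exp_nonneg by (intro add_mono mult_right_mono) auto
  also have "\<dots> = C * (edge_weight y1 + edge_weight y2)"
    by (simp add: edge_weight_def y1_def y2_def algebra_simps)
  finally show ?thesis by (simp add: y1_def y2_def)
qed

lemma abs_tensor_rest_le:
  assumes "\<And>j. \<bar>h j (x $ j)\<bar> \<le> (C::real)"
  shows "\<bar>\<Prod>j\<in>UNIV - {i}. h j (x $ j)\<bar> \<le> (\<Prod>j\<in>UNIV - {i}. C)"
  unfolding abs_prod by (rule prod_mono) (use assms in auto)

context neumann_box
begin

lemma tensor_cutoff_test_function: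
  assumes "\<And>j. smooth (h j)"
  shows "tensor (\<lambda>j t. h j t * cutoff (a $ j) n t) \<in> test_functions D"
proof (cases "n = 0")
  case True
  then have "tensor (\<lambda>j t. h j t * cutoff (a $ j) n t) = (\<lambda>_. 0)"
    using assms by (auto simp: tensor_def cutoff_def flat_exp_def fun_eq_iff)
  moreover have "C_diff k (\<lambda>_ :: real ^ 'n. 0)" for k
  proof (induction k)
    case (Suc k)
    have "partial_deriv i (\<lambda>_ :: real ^ 'n. 0) = (\<lambda>_. 0)" for i
      by (rule ext) (auto intro: partial_deriv_eq_0_if_vanishing[of UNIV])
    with Suc show ?case by simp
  qed simp
  ultimately show ?thesis by (simp add: test_functions_def)
next
  case False
  define r :: "real ^ 'n" where "r = (\<chi> j. a $ j - 1 / real n)"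
  let ?T = "tensor (\<lambda>j t. h j t * cutoff (a $ j) n t)"
  have "{x. ?T x \<noteq> 0} \<subseteq> cbox (- r) r"
  proof
    fix x assume "x \<in> {x. ?T x \<noteq> 0}"
    then have "cutoff (a $ j) n (x $ j) \<noteq> 0" for j by (auto simp: tensor_def)
    from cutoff_support[OF this] show "x \<in> cbox (- r) r"
      using False by (auto simp: mem_box_cart r_def field_simps)
  qed
  then have "closure {x. ?T x \<noteq> 0} \<subseteq> cbox (- r) r"
    by (rule closure_minimal) (rule closed_cbox)
  moreover have "cbox (- r) r \<subseteq> D"
    using False by (auto simp: subset_iff mem_box_cart r_def) (smt (verit) divide_pos_pos of_nat_0_less_iff)+
  ultimately have "closure {x. ?T x \<noteq> 0} \<subseteq> D" "compact (closure {x. ?T x \<noteq> 0})"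
    using compact_closure bounded_subset[OF bounded_cbox] closure_subset by blast+
  moreover have "C_diff k ?T" for k
    by (intro C_diff_tensor smooth_mult assms smooth_cutoff)
  ultimately show ?thesis by (simp add: test_functions_def)
qed

text \<open>
  The product \<open>tensor h\<close> is no test function, as it need not vanish near the boundary. Cutting off
  every factor gives test functions, and the formula for \<open>tensor h\<close> follows by dominated convergence.
  The one dangerous term is \<open>h i\<close> times the derivative of its cutoff; it stays bounded and tends
  to \<open>0\<close> because \<open>h i\<close> vanishes at both ends and is therefore bounded by a multiple of the
  distance to them. The cutoffs in the other coordinates are not differentiated and just converge
  to \<open>1\<close>.
\<close>

lemma integration_by_parts_tensor:
  assumes w: "w \<in> L2_on D" and G: "weak_gradient D w G"
    and smooth: "\<And>j. smooth (h j)"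
    and deriv: "\<And>j t. (h j has_real_derivative h' j t) (at t)"
    and edge: "h i (- a $ i) = 0" "h i (a $ i) = 0"
  shows "integral\<^sup>L (lebesgue_on D) (\<lambda>x. G x $ i * tensor h x) =
    - integral\<^sup>L (lebesgue_on D) (\<lambda>x. w x * tensor (h(i := h' i)) x)"
proof -
  have smooth': "smooth (h' j)" for j
    by (rule smooth_derivative[OF smooth deriv])
  have cont: "continuous_on UNIV (f :: real \<Rightarrow> real)" if "smooth f" for f
    using smooth_has_derivative[OF that] by (meson DERIV_isCont continuous_at_imp_continuous_on)
  have "\<exists>C. \<forall>t\<in>{- a $ j..a $ j}. \<bar>h j t\<bar> \<le> C \<and> \<bar>h' j t\<bar> \<le> C" for j
  proof -
    have "\<exists>B. \<forall>t\<in>{- a $ j..a $ j}. \<bar>f t\<bar> \<le> B" if "smooth f" for f :: "real \<Rightarrow> real"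
    proof -
      have "compact (f ` {- a $ j..a $ j})"
        by (intro compact_continuous_image continuous_on_subset[OF cont[OF that]]) auto
      then show ?thesis by (auto dest!: compact_imp_bounded simp: bounded_iff)
    qed
    from this[OF smooth] this[OF smooth'] obtain A B where
      "\<forall>t\<in>{- a $ j..a $ j}. \<bar>h j t\<bar> \<le> A" "\<forall>t\<in>{- a $ j..a $ j}. \<bar>h' j t\<bar> \<le> B"
      by blast
    then show ?thesis by (intro exI[of _ "max A B"]) (auto simp: le_max_iff_disj)
  qed
  then obtain Cj where Cj: "\<forall>j. \<forall>t\<in>{- a $ j..a $ j}. \<bar>h j t\<bar> \<le> Cj j \<and> \<bar>h' j t\<bar> \<le> Cj j"
    using choice[of "\<lambda>j C. \<forall>t\<in>{- a $ j..a $ j}. \<bar>h j t\<bar> \<le> C \<and> \<bar>h' j t\<bar> \<le> C"] by blast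
  define C where "C = (\<Sum>j\<in>UNIV. \<bar>Cj j\<bar>)"
  have "Cj j \<le> C" for j
    unfolding C_def using member_le_sum[of j UNIV "\<lambda>j. \<bar>Cj j\<bar>"] by (simp add: abs_le_iff)
  then have C: "\<bar>h j t\<bar> \<le> C" "\<bar>h' j t\<bar> \<le> C" if "- a $ j \<le> t" "t \<le> a $ j" for j t
    using Cj that by (meson atLeastAtMost_iff order_trans)+
  have C0: "C \<ge> 0" by (simp add: C_def sum_nonneg)
  have edge_bound: "\<bar>h i t\<bar> \<le> C * (t + a $ i)" "\<bar>h i t\<bar> \<le> C * (a $ i - t)"
    if t: "- a $ i < t" "t < a $ i" for t
  proof -
    obtain z where z: "- a $ i < z" "z < t" "h i t - h i (- a $ i) = (t - (- a $ i)) * h' i z"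
      using MVT2[OF t(1), of "h i" "h' i"] deriv by blast
    have "\<bar>h i t\<bar> = \<bar>t + a $ i\<bar> * \<bar>h' i z\<bar>"
      using z(3) by (simp add: edge flip: abs_mult)
    also have "\<dots> \<le> \<bar>t + a $ i\<bar> * C"
      using C(2)[of i z] z t by (intro mult_left_mono) auto
    finally show "\<bar>h i t\<bar> \<le> C * (t + a $ i)"
      using t by (simp add: mult.commute)
    obtain z where z: "t < z" "z < a $ i" "h i (a $ i) - h i t = (a $ i - t) * h' i z"
      using MVT2[OF t(2), of "h i" "h' i"] deriv by blast
    have "h i t = - ((a $ i - t) * h' i z)" using z(3) edge by simp
    then have "\<bar>h i t\<bar> = \<bar>a $ i - t\<bar> * \<bar>h' i z\<bar>"
      by (simp only: abs_minus_cancel abs_mult)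
    also have "\<dots> \<le> \<bar>a $ i - t\<bar> * C"
      using C(2)[of i z] z t by (intro mult_left_mono) auto
    finally show "\<bar>h i t\<bar> \<le> C * (a $ i - t)"
      using t by (simp add: mult.commute)
  qed
  \<comment> \<open>The factors after cutting off, and their derivatives.\<close>
  define hc where "hc n = (\<lambda>j t. h j t * cutoff (a $ j) n t)" for n
  define hc' where "hc' n = (\<lambda>j t. h' j t * cutoff (a $ j) n t + h j t * cutoff_deriv (a $ j) n t)" for n
  have hc': "(hc n j has_real_derivative hc' n j t) (at t)" for n j t
    unfolding hc_def hc'_def
    by (rule derivative_eq_intros deriv cutoff_has_derivative refl)+ (simp add: algebra_simps)
  have int_w: "integrable (lebesgue_on D) w" using w by (rule L2_integrable)
  have int_G: "integrable (lebesgue_on D) (\<lambda>x. G x $ i)"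
    using G by (auto simp: weak_gradient_def intro: L2_integrable)
  have cont_tensor: "continuous_on UNIV (tensor g)" if "\<And>j. smooth (g j)" for g :: "'n \<Rightarrow> real \<Rightarrow> real"
    using C_diff_tensor[of g 0] that by simp
  have smooth_hc: "smooth (hc n j)" for n j
    unfolding hc_def by (intro smooth_mult smooth smooth_cutoff)
  have smooth_hc': "smooth (hc' n j)" for n j
    using smooth_derivative[OF smooth_hc hc'] .
  have D_bounds: "- a $ j < x $ j" "x $ j < a $ j" if "x \<in> space (lebesgue_on D)" for x j
    using that by (auto simp: mem_D)
  have hc_le: "\<bar>hc n j (x $ j)\<bar> \<le> C" if "x \<in> space (lebesgue_on D)" for n j x
  proof -
    have "\<bar>h j (x $ j)\<bar> * \<bar>cutoff (a $ j) n (x $ j)\<bar> \<le> C * 1"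
      using C(1)[of j "x $ j"] D_bounds[OF that] cutoff_bounds C0
      by (intro mult_mono) (auto simp: less_imp_le)
    then show ?thesis by (simp add: hc_def abs_mult)
  qed
  have hc_tendsto: "(\<lambda>n. hc n j (x $ j)) \<longlonglongrightarrow> h j (x $ j)" if "x \<in> space (lebesgue_on D)" for j x
  proof -
    have "(\<lambda>n. hc n j (x $ j)) \<longlonglongrightarrow> h j (x $ j) * 1"
      unfolding hc_def using D_bounds[OF that] by (intro tendsto_intros cutoff_tendsto_1)
    then show ?thesis by simp
  qed
  define P where "P = (\<Prod>j\<in>UNIV - {i}. C)"
  have P0: "P \<ge> 0" unfolding P_def using C0 by (intro prod_nonneg) simp
  have lim_G: "(\<lambda>n. integral\<^sup>L (lebesgue_on D) (\<lambda>x. G x $ i * tensor (hc n) x)) \<longlonglongrightarrow>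
      integral\<^sup>L (lebesgue_on D) (\<lambda>x. G x $ i * tensor h x)"
  proof (rule integral_dominated_convergence[where w = "\<lambda>x. \<bar>G x $ i\<bar> * (C * P)"])
    show "(\<lambda>x. G x $ i * tensor h x) \<in> borel_measurable (lebesgue_on D)"
      using integrable_mult_continuous[OF int_G cont_tensor[OF smooth]] by (rule borel_measurable_integrable)
    show "(\<lambda>x. G x $ i * tensor (hc n) x) \<in> borel_measurable (lebesgue_on D)" for n
      using integrable_mult_continuous[OF int_G cont_tensor[OF smooth_hc]] by (rule borel_measurable_integrable)
    show "integrable (lebesgue_on D) (\<lambda>x. \<bar>G x $ i\<bar> * (C * P))"
      using int_G by simp
    show "AE x in lebesgue_on D. (\<lambda>n. G x $ i * tensor (hc n) x) \<longlonglongrightarrow> G x $ i * tensor h x"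
      unfolding tensor_def by (intro AE_I2 tendsto_intros hc_tendsto)
    show "AE x in lebesgue_on D. norm (G x $ i * tensor (hc n) x) \<le> \<bar>G x $ i\<bar> * (C * P)" for n
    proof (rule AE_I2)
      fix x assume x: "x \<in> space (lebesgue_on D)"
      have "\<bar>tensor (hc n) x\<bar> = \<bar>hc n i (x $ i)\<bar> * \<bar>\<Prod>j\<in>UNIV - {i}. hc n j (x $ j)\<bar>"
        using tensor_update[of "hc n" i "hc n i" x] by (simp add: abs_mult)
      also have "\<dots> \<le> C * P"
        unfolding P_def using hc_le[OF x] C0 by (intro mult_mono abs_tensor_rest_le) auto
      finally show "norm (G x $ i * tensor (hc n) x) \<le> \<bar>G x $ i\<bar> * (C * P)"
        by (simp add: abs_mult mult_left_mono)
    qed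
  qed
  \<comment> \<open>The derivative of the factor \<open>i\<close> is at most \<open>C + C (3 + 3) = 7 C\<close>: one term from
      \<open>h' i\<close>, and two edge weights of at most \<open>3\<close>.\<close>
  have lim_w: "(\<lambda>n. integral\<^sup>L (lebesgue_on D) (\<lambda>x. w x * tensor ((hc n)(i := hc' n i)) x)) \<longlonglongrightarrow>
      integral\<^sup>L (lebesgue_on D) (\<lambda>x. w x * tensor (h(i := h' i)) x)"
  proof (rule integral_dominated_convergence[where w = "\<lambda>x. \<bar>w x\<bar> * (7 * C * P)"])
    have "smooth ((h(i := h' i)) j)" for j using smooth smooth' by simp
    from integrable_mult_continuous[OF int_w cont_tensor[OF this]]
    show "(\<lambda>x. w x * tensor (h(i := h' i)) x) \<in> borel_measurable (lebesgue_on D)"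
      by (rule borel_measurable_integrable)
    have "smooth (((hc n)(i := hc' n i)) j)" for n j using smooth_hc smooth_hc' by simp
    from integrable_mult_continuous[OF int_w cont_tensor[OF this]]
    show "(\<lambda>x. w x * tensor ((hc n)(i := hc' n i)) x) \<in> borel_measurable (lebesgue_on D)" for n
      by (rule borel_measurable_integrable)
    show "integrable (lebesgue_on D) (\<lambda>x. \<bar>w x\<bar> * (7 * C * P))"
      using int_w by simp
    have edge_n: "\<bar>h i (x $ i) * cutoff_deriv (a $ i) n (x $ i)\<bar> \<le>
        C * (edge_weight (real n * (x $ i + a $ i) - 1) + edge_weight (real n * (a $ i - x $ i) - 1))"
      if "x \<in> space (lebesgue_on D)" for x n
      using D_bounds[OF that] by (intro abs_cutoff_deriv_le edge_bound)
    show "AE x in lebesgue_on D. (\<lambda>n. w x * tensor ((hc n)(i := hc' n i)) x) \<longlonglongrightarrow>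
        w x * tensor (h(i := h' i)) x"
    proof (rule AE_I2)
      fix x assume x: "x \<in> space (lebesgue_on D)"
      have "(\<lambda>n. C * (edge_weight (real n * (x $ i + a $ i) - 1) + edge_weight (real n * (a $ i - x $ i) - 1)))
          \<longlonglongrightarrow> C * (0 + 0)"
      proof (intro tendsto_mult tendsto_add tendsto_const filterlim_compose[OF edge_weight_tendsto_0] affine_at_top)
        show "0 < x $ i + a $ i" "0 < a $ i - x $ i" using D_bounds[OF x, of i] by linarith+
      qed
      moreover have "\<forall>\<^sub>F n in sequentially. norm (h i (x $ i) * cutoff_deriv (a $ i) n (x $ i)) \<le>
          C * (edge_weight (real n * (x $ i + a $ i) - 1) + edge_weight (real n * (a $ i - x $ i) - 1))"
        unfolding real_norm_def by (rule always_eventually, rule allI, rule edge_n[OF x])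
      ultimately have edge_lim: "(\<lambda>n. h i (x $ i) * cutoff_deriv (a $ i) n (x $ i)) \<longlonglongrightarrow> 0"
        unfolding add_0_left mult_zero_right by (rule Lim_null_comparison[rotated])
      have "(\<lambda>n. hc' n i (x $ i)) \<longlonglongrightarrow> h' i (x $ i) * 1 + 0"
        unfolding hc'_def using D_bounds[OF x]
        by (intro tendsto_add tendsto_mult tendsto_const cutoff_tendsto_1 edge_lim)
      then have "(\<lambda>n. hc' n i (x $ i)) \<longlonglongrightarrow> h' i (x $ i)" by simp
      then show "(\<lambda>n. w x * tensor ((hc n)(i := hc' n i)) x) \<longlonglongrightarrow> w x * tensor (h(i := h' i)) x"
        unfolding tensor_update by (intro tendsto_intros hc_tendsto[OF x])
    qed
    show "AE x in lebesgue_on D. norm (w x * tensor ((hc n)(i := hc' n i)) x) \<le> \<bar>w x\<bar> * (7 * C * P)" for n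
    proof (rule AE_I2)
      fix x assume x: "x \<in> space (lebesgue_on D)"
      have "\<bar>h' i (x $ i) * cutoff (a $ i) n (x $ i)\<bar> \<le> C * 1"
        unfolding abs_mult using C(2)[of i "x $ i"] D_bounds[OF x] cutoff_bounds C0
        by (intro mult_mono) (auto simp: less_imp_le)
      moreover have "\<bar>h i (x $ i) * cutoff_deriv (a $ i) n (x $ i)\<bar> \<le> C * (3 + 3)"
        using C0 edge_weight_bounds
        by (intro order_trans[OF edge_n[OF x]] mult_left_mono add_mono)
      ultimately have "\<bar>hc' n i (x $ i)\<bar> \<le> C * 1 + C * (3 + 3)"
        unfolding hc'_def by (intro order_trans[OF abs_triangle_ineq] add_mono)
      then have "\<bar>hc' n i (x $ i)\<bar> \<le> 7 * C" by simp
      then have "\<bar>tensor ((hc n)(i := hc' n i)) x\<bar> \<le> 7 * C * P"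
        unfolding tensor_update abs_mult P_def using hc_le[OF x] C0
        by (intro mult_mono abs_tensor_rest_le) auto
      then show "norm (w x * tensor ((hc n)(i := hc' n i)) x) \<le> \<bar>w x\<bar> * (7 * C * P)"
        by (simp add: abs_mult mult_left_mono)
    qed
  qed
  have eq: "integral\<^sup>L (lebesgue_on D) (\<lambda>x. w x * tensor ((hc n)(i := hc' n i)) x) =
      - integral\<^sup>L (lebesgue_on D) (\<lambda>x. G x $ i * tensor (hc n) x)" for n
  proof -
    have slope: "partial_deriv i (tensor (hc n)) = tensor ((hc n)(i := hc' n i))"
      unfolding tensor_update by (rule ext, rule partial_deriv_tensor) (rule hc')
    have "tensor (hc n) \<in> test_functions D"
      unfolding hc_def by (rule tensor_cutoff_test_function[OF smooth])
    then have "integral\<^sup>L (lebesgue_on D) (\<lambda>x. w x * partial_deriv i (tensor (hc n)) x) =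
        - integral\<^sup>L (lebesgue_on D) (\<lambda>x. G x $ i * tensor (hc n) x)"
      using G unfolding weak_gradient_def by blast
    then show ?thesis unfolding slope .
  qed
  have "(\<lambda>n. - integral\<^sup>L (lebesgue_on D) (\<lambda>x. G x $ i * tensor (hc n) x)) \<longlonglongrightarrow>
      integral\<^sup>L (lebesgue_on D) (\<lambda>x. w x * tensor (h(i := h' i)) x)"
    using lim_w by (simp add: eq)
  from LIMSEQ_unique[OF this tendsto_minus[OF lim_G]] show ?thesis by simp
qed

section \<open>Neumann modes\<close>

text \<open>
  The phase is chosen such that the modes have slope \<open>0\<close> on the faces $x_i = -a_i$ for all
  frequencies; \<open>admissible\<close> gives the same on the opposite faces.
\<close>

definition mode :: "real ^ 'n \<Rightarrow> real ^ 'n \<Rightarrow> real" where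
  "mode \<omega> = tensor (\<lambda>i t. cos (\<omega> $ i * (t + a $ i)))"

definition admissible :: "real ^ 'n \<Rightarrow> bool" where
  "admissible \<omega> \<longleftrightarrow> (\<forall>i. sin (2 * \<omega> $ i * a $ i) = 0)"

lemma smooth_cos_factor: "smooth (\<lambda>t. cos (p * (t + q)))"
  using smooth_affine[of cos p "p * q"] smooth_sin_cos by (simp add: distrib_left)

lemma C_diff_mode: "C_diff k (mode \<omega>)"
  unfolding mode_def by (intro C_diff_tensor smooth_cos_factor)

lemma continuous_mode: "continuous_on S (mode \<omega>)"
  using C_diff_mode[of 0] by (auto intro: continuous_on_subset)

lemma mode_weak_gradient: "weak_gradient D (mode \<omega>) (\<lambda>x. \<chi> i. partial_deriv i (mode \<omega>) x)"
  by (rule weak_gradient_classical) (rule C_diff_mode)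

lemma mode_L2: "mode \<omega> \<in> L2_on D"
  by (rule continuous_in_L2) (rule continuous_mode)

text \<open>
  The slope in direction \<open>i\<close> contains the factor $\sin(\omega_i (x_i + a_i))$, which vanishes on both
  faces orthogonal to this direction.
\<close>

lemma mode_integration_by_parts:
  assumes w: "w \<in> L2_on D" "weak_gradient D w G" and \<omega>: "admissible \<omega>"
  shows "integral\<^sup>L (lebesgue_on D) (\<lambda>x. G x $ i * partial_deriv i (mode \<omega>) x) =
    (\<omega> $ i)\<^sup>2 * integral\<^sup>L (lebesgue_on D) (\<lambda>x. w x * mode \<omega> x)"
proof -
  let ?h = "\<lambda>i t. cos (\<omega> $ i * (t + a $ i))"
  let ?h' = "\<lambda>i t. - \<omega> $ i * sin (\<omega> $ i * (t + a $ i))"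
  have d: "(?h j has_real_derivative ?h' j t) (at t)" for j t
    by (auto intro!: derivative_eq_intros)
  have d': "(?h' j has_real_derivative - (\<omega> $ j)\<^sup>2 * ?h j t) (at t)" for j t
    by (auto intro!: derivative_eq_intros simp: power2_eq_square)
  have slope: "partial_deriv i (mode \<omega>) = tensor (?h(i := ?h' i))"
    unfolding mode_def tensor_update by (rule ext, rule partial_deriv_tensor) (rule d)
  have smooth: "smooth ((?h(i := ?h' i)) j)" for j
    using smooth_cos_factor smooth_derivative[OF smooth_cos_factor d] by simp
  define k where "k = (\<lambda>j t. if j = i then - (\<omega> $ j)\<^sup>2 * ?h j t else ?h' j t)"
  have "integral\<^sup>L (lebesgue_on D) (\<lambda>x. G x $ i * tensor (?h(i := ?h' i)) x) =
      - integral\<^sup>L (lebesgue_on D) (\<lambda>x. w x * tensor ((?h(i := ?h' i))(i := k i)) x)"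
  proof (rule integration_by_parts_tensor[OF w smooth])
    show "((?h(i := ?h' i)) j has_real_derivative k j t) (at t)" for j t
      using d[of j t] d'[of j t] by (cases "j = i") (simp_all add: k_def)
    show "(?h(i := ?h' i)) i (- a $ i) = 0" by simp
    show "(?h(i := ?h' i)) i (a $ i) = 0"
      using \<omega> by (simp add: admissible_def mult.commute mult.left_commute flip: mult_2)
  qed
  moreover have "tensor ((?h(i := ?h' i))(i := k i)) x = - (\<omega> $ i)\<^sup>2 * mode \<omega> x" for x
    unfolding mode_def fun_upd_upd tensor_update k_def
    unfolding tensor_def prod.remove[OF finite UNIV_I, of _ i] by simp
  ultimately show ?thesis
    unfolding slope by (simp add: mult.left_commute[of _ "(\<omega> $ i)\<^sup>2"])
qed

text \<open>
  Both squares arise from integrating the same product of slopes by parts, once in favour of each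
  of the two modes.
\<close>

lemma modes_orthogonal:
  assumes "admissible \<omega>" "admissible \<omega>'" "(\<omega> $ i)\<^sup>2 \<noteq> (\<omega>' $ i)\<^sup>2"
  shows "integral\<^sup>L (lebesgue_on D) (\<lambda>x. mode \<omega> x * mode \<omega>' x) = 0"
proof -
  have "(\<omega> $ i)\<^sup>2 * integral\<^sup>L (lebesgue_on D) (\<lambda>x. mode \<omega> x * mode \<omega>' x) =
      (\<omega>' $ i)\<^sup>2 * integral\<^sup>L (lebesgue_on D) (\<lambda>x. mode \<omega> x * mode \<omega>' x)"
    using mode_integration_by_parts[OF mode_L2 mode_weak_gradient assms(1), of \<omega>' i]
      mode_integration_by_parts[OF mode_L2 mode_weak_gradient assms(2), of \<omega> i]
    by (simp add: mult.commute)
  with assms(3) show ?thesis by simp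
qed

lemma continuous_AE_eq_0:
  fixes f :: "real ^ 'n \<Rightarrow> real"
  assumes "continuous_on (closure D) f" "AE x in lebesgue_on D. f x = 0" "x \<in> closure D"
  shows "f x = 0"
  using continuous_extension_unique[of D "\<lambda>_. 0" f "\<lambda>_. 0" x] assms
  by (auto simp: continuous_extension_def)

lemma continuous_nonneg_integral_eq_0:
  fixes f :: "real ^ 'n \<Rightarrow> real"
  assumes "continuous_on UNIV f" "\<And>x. x \<in> D \<Longrightarrow> f x \<ge> 0" "integral\<^sup>L (lebesgue_on D) f = 0"
    and "x \<in> closure D"
  shows "f x = 0"
proof (rule continuous_AE_eq_0)
  show "AE x in lebesgue_on D. f x = 0"
    using assms(2,3) integrable_continuous[OF assms(1)]
    by (subst integral_nonneg_eq_0_iff_AE[symmetric]) auto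
qed (use assms in \<open>auto intro: continuous_on_subset\<close>)

lemma neg_a_in_closure: "- a \<in> closure D"
  using a_pos by (simp add: closure_D mem_box_cart less_imp_le)

lemma mode_at_corner: "mode \<omega> (- a) = 1"
  by (simp add: mode_def tensor_def)

lemma mode_norm_pos: "integral\<^sup>L (lebesgue_on D) (\<lambda>x. (mode \<omega> x)\<^sup>2) > 0"
proof -
  have "integral\<^sup>L (lebesgue_on D) (\<lambda>x. (mode \<omega> x)\<^sup>2) \<noteq> 0"
    using continuous_nonneg_integral_eq_0[of "\<lambda>x. (mode \<omega> x)\<^sup>2", OF _ _ _ neg_a_in_closure]
    by (auto simp: mode_at_corner intro!: continuous_intros continuous_mode)
  moreover have "integral\<^sup>L (lebesgue_on D) (\<lambda>x. (mode \<omega> x)\<^sup>2) \<ge> 0"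
    by (rule Bochner_Integration.integral_nonneg) simp
  ultimately show ?thesis by linarith
qed

section \<open>Completeness of the modes\<close>

text \<open>
  Linear combinations inherit orthogonality from the modes, so multiplication is left out of the
  rules. That products stay in the class is proved below, as Stone-Weierstrass asks for an algebra.
\<close>

inductive cos_poly :: "(real ^ 'n \<Rightarrow> real) \<Rightarrow> bool" where
  mode: "admissible \<omega> \<Longrightarrow> cos_poly (mode \<omega>)"
| add: "cos_poly f \<Longrightarrow> cos_poly g \<Longrightarrow> cos_poly (\<lambda>x. f x + g x)"
| scale: "cos_poly f \<Longrightarrow> cos_poly (\<lambda>x. c * f x)"

lemma mode_shift:
  "mode (\<omega> + axis i s) x =
    cos ((\<omega> $ i + s) * (x $ i + a $ i)) * (\<Prod>j\<in>UNIV - {i}. cos (\<omega> $ j * (x $ j + a $ j)))"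
  unfolding mode_def tensor_def
  by (subst prod.remove[of _ i]) (auto simp: axis_def intro!: prod.cong)

lemma mode_zero: "mode 0 = (\<lambda>_. 1)"
  by (auto simp: mode_def tensor_def)

lemma mode_axis: "mode (axis i s) x = cos (s * (x $ i + a $ i))"
  using mode_shift[of 0 i s x] by simp

lemma admissible_zero: "admissible 0"
  by (simp add: admissible_def)

lemma admissible_axis: "sin (2 * s * a $ i) = 0 \<Longrightarrow> admissible (axis i s)"
  by (auto simp: admissible_def axis_def)

lemma admissible_add: "admissible \<omega> \<Longrightarrow> admissible \<omega>' \<Longrightarrow> admissible (\<omega> + \<omega>')"
  by (simp add: admissible_def distrib_left distrib_right sin_add)

lemma mode_mult_cos:
  "mode \<omega> x * cos (s * (x $ i + a $ i)) = (mode (\<omega> + axis i s) x + mode (\<omega> + axis i (- s)) x) / 2"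
proof -
  define y where "y = x $ i + a $ i"
  define P where "P = (\<Prod>j\<in>UNIV - {i}. cos (\<omega> $ j * (x $ j + a $ j)))"
  have "mode \<omega> x = cos (\<omega> $ i * y) * P"
    unfolding mode_def tensor_def y_def P_def by (rule prod.remove) auto
  moreover have "2 * (cos (\<omega> $ i * y) * cos (s * y)) = cos ((\<omega> $ i + s) * y) + cos ((\<omega> $ i + - s) * y)"
    by (simp add: distrib_right cos_add left_diff_distrib cos_diff)
  then have "cos (\<omega> $ i * y) * P * cos (s * y) =
      (cos ((\<omega> $ i + s) * y) * P + cos ((\<omega> $ i + - s) * y) * P) / 2"
    by (simp flip: distrib_right)
  ultimately show ?thesis
    unfolding mode_shift y_def[symmetric] P_def[symmetric] by simp
qed

text \<open>
  The factors of \<open>mode \<omega>\<close> are multiplied one at a time, each by the product formula for cosines;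
  hence the induction over sets \<open>J\<close> of coordinates.
\<close>

lemma cos_poly_mult_mode:
  assumes "admissible \<omega>" "cos_poly f"
  shows "cos_poly (\<lambda>x. f x * mode \<omega> x)"
  using assms(2)
proof induction
  case (mode \<omega>')
  have "cos_poly (\<lambda>x. mode \<omega>'' x * (\<Prod>j\<in>J. cos (\<omega> $ j * (x $ j + a $ j))))"
    if "admissible \<omega>''" for \<omega>'' J
    using finite[of J] that
  proof (induction J arbitrary: \<omega>'' rule: finite_induct)
    case empty
    then show ?case by (simp add: cos_poly.mode)
  next
    case (insert j J)
    have adm: "admissible (axis j (\<omega> $ j))" "admissible (axis j (- (\<omega> $ j)))"
      using assms(1) by (auto simp: admissible_def axis_def)
    let ?P = "\<lambda>x. \<Prod>j\<in>J. cos (\<omega> $ j * (x $ j + a $ j))"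
    have "cos_poly (\<lambda>x. 1 / 2 * (mode (\<omega>'' + axis j (\<omega> $ j)) x * ?P x + mode (\<omega>'' + axis j (- (\<omega> $ j))) x * ?P x))"
      using insert.prems adm by (intro cos_poly.intros insert.IH admissible_add)
    also have "(\<lambda>x. 1 / 2 * (mode (\<omega>'' + axis j (\<omega> $ j)) x * ?P x + mode (\<omega>'' + axis j (- (\<omega> $ j))) x * ?P x)) =
        (\<lambda>x. mode \<omega>'' x * (\<Prod>j\<in>insert j J. cos (\<omega> $ j * (x $ j + a $ j))))"
      using insert.hyps by (simp add: mode_mult_cos distrib_right flip: mult.assoc)
    finally show ?case .
  qed
  from this[OF mode, of UNIV] show ?case by (simp add: mode_def tensor_def)
next
  case (add f g)
  then show ?case by (simp add: distrib_right cos_poly.add)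
next
  case (scale f c)
  then show ?case by (simp add: mult.assoc cos_poly.scale)
qed

lemma cos_poly_mult:
  assumes "cos_poly f" "cos_poly g"
  shows "cos_poly (\<lambda>x. f x * g x)"
  using assms(2)
proof induction
  case (mode \<omega>)
  then show ?case using cos_poly_mult_mode assms(1) by simp
next
  case (add g1 g2)
  then show ?case by (simp add: distrib_left cos_poly.add)
next
  case (scale g c)
  then show ?case using cos_poly.scale[of "\<lambda>x. f x * g x" c] by (simp add: mult.left_commute)
qed

lemma continuous_cos_poly: "cos_poly f \<Longrightarrow> continuous_on UNIV f"
  by (induction rule: cos_poly.induct) (intro continuous_intros continuous_mode; assumption)+

text \<open>
  The lowest nonconstant mode of an axis is monotone along this axis.
\<close>

lemma cos_poly_separates:
  assumes "x \<in> closure D" "y \<in> closure D" "x \<noteq> y"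
  shows "\<exists>f. cos_poly f \<and> f x \<noteq> f y"
proof -
  obtain i where i: "x $ i \<noteq> y $ i" using assms(3) by (auto simp: vec_eq_iff)
  define s where "s = pi / (2 * a $ i)"
  have s: "s > 0" "2 * s * a $ i = pi" using a_pos[of i] by (auto simp: s_def)
  have range: "0 \<le> s * (z $ i + a $ i)" "s * (z $ i + a $ i) \<le> pi" if "z \<in> closure D" for z
  proof -
    have z: "- a $ i \<le> z $ i" "z $ i \<le> a $ i" using that by (auto simp: closure_D mem_box_cart)
    show "0 \<le> s * (z $ i + a $ i)" using s(1) z by simp
    have "s * (z $ i + a $ i) \<le> s * (2 * a $ i)" using s(1) z by (intro mult_left_mono) auto
    then show "s * (z $ i + a $ i) \<le> pi" using s(2) by simp
  qed
  have "mode (axis i s) x \<noteq> mode (axis i s) y"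
    unfolding mode_axis using cos_inj_pi[OF range[OF assms(1)] range[OF assms(2)]] i s(1) by auto
  moreover have "cos_poly (mode (axis i s))"
    using s(2) by (intro cos_poly.mode admissible_axis) simp
  ultimately show ?thesis by blast
qed

lemma cos_poly_dense:
  assumes "continuous_on UNIV f" "e > 0"
  shows "\<exists>p. cos_poly p \<and> (\<forall>x\<in>closure D. \<bar>f x - p x\<bar> < e)"
proof (rule Stone_Weierstrass_HOL[where P = cos_poly])
  show "compact (closure D)" by (simp add: closure_D)
  show "cos_poly (\<lambda>_. c)" for c
    using cos_poly.scale[OF cos_poly.mode[OF admissible_zero], of c] by (simp add: mode_zero)
  show "continuous_on (closure D) p" if "cos_poly p" for p
    using continuous_cos_poly[OF that] by (rule continuous_on_subset) simp
  show "continuous_on (closure D) f"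
    using assms(1) by (rule continuous_on_subset) simp
qed (use assms(2) cos_poly_separates cos_poly_mult cos_poly.add in auto)

text \<open>
  By Stone-Weierstrass, \<open>w\<close> is orthogonal to all continuous functions. As \<open>sgn w\<close> is a bounded
  almost everywhere limit of these, the integral of $|w| = w \cdot \mathrm{sgn}\, w$ is zero.
\<close>

lemma modes_complete:
  assumes w: "integrable (lebesgue_on D) w"
    and orth: "\<And>\<omega>. admissible \<omega> \<Longrightarrow> integral\<^sup>L (lebesgue_on D) (\<lambda>x. w x * mode \<omega> x) = 0"
  shows "AE x in lebesgue_on D. w x = 0"
proof -
  have poly: "integral\<^sup>L (lebesgue_on D) (\<lambda>x. w x * p x) = 0" if "cos_poly p" for p
    using that
  proof induction
    case (mode \<omega>)
    then show ?case by (rule orth)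
  next
    case (add f g)
    then show ?case
      using w continuous_cos_poly integrable_mult_continuous by (simp add: distrib_left)
  next
    case (scale f c)
    then show ?case by (simp add: mult.left_commute)
  qed
  have cont: "integral\<^sup>L (lebesgue_on D) (\<lambda>x. w x * f x) = 0" if f: "continuous_on UNIV f" for f
  proof -
    define A where "A = integral\<^sup>L (lebesgue_on D) (\<lambda>x. \<bar>w x\<bar>)"
    have le: "\<bar>integral\<^sup>L (lebesgue_on D) (\<lambda>x. w x * f x)\<bar> \<le> e * A" if "e > 0" for e
    proof -
      obtain p where p: "cos_poly p" "\<forall>x\<in>closure D. \<bar>f x - p x\<bar> < e"
        using cos_poly_dense[OF f \<open>e > 0\<close>] by blast
      have int: "integrable (lebesgue_on D) (\<lambda>x. w x * f x)" "integrable (lebesgue_on D) (\<lambda>x. w x * p x)"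
        using w f continuous_cos_poly[OF p(1)] integrable_mult_continuous by auto
      have "integral\<^sup>L (lebesgue_on D) (\<lambda>x. w x * f x) = integral\<^sup>L (lebesgue_on D) (\<lambda>x. w x * f x - w x * p x)"
        using int poly[OF p(1)] by simp
      also have "\<bar>\<dots>\<bar> \<le> integral\<^sup>L (lebesgue_on D) (\<lambda>x. e * \<bar>w x\<bar>)"
      proof (rule order_trans[OF integral_abs_bound], rule integral_mono)
        fix x assume "x \<in> space (lebesgue_on D)"
        then have "x \<in> closure D" using closure_subset[of D] by auto
        then have "\<bar>w x\<bar> * \<bar>f x - p x\<bar> \<le> \<bar>w x\<bar> * e"
          using p(2) by (intro mult_left_mono) (auto simp: less_imp_le)
        then show "\<bar>w x * f x - w x * p x\<bar> \<le> e * \<bar>w x\<bar>"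
          by (simp add: mult.commute[of e] abs_mult flip: right_diff_distrib)
      qed (use int w in auto)
      finally show ?thesis by (simp add: A_def)
    qed
    have A: "A \<ge> 0" by (auto simp: A_def intro!: Bochner_Integration.integral_nonneg)
    have "\<bar>integral\<^sup>L (lebesgue_on D) (\<lambda>x. w x * f x)\<bar> \<le> 0"
    proof (rule field_le_epsilon)
      fix e :: real assume "e > 0"
      then have "e / (A + 1) * A \<le> e" "e / (A + 1) > 0"
        using A by (simp_all add: field_simps)
      then show "\<bar>integral\<^sup>L (lebesgue_on D) (\<lambda>x. w x * f x)\<bar> \<le> 0 + e"
        using le[of "e / (A + 1)"] by simp
    qed
    then show ?thesis by simp
  qed
  have "(\<lambda>x. sgn (w x)) \<in> borel_measurable (lebesgue_on D)"
    using borel_measurable_integrable[OF w] by measurable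
  then have "(\<lambda>x. sgn (w x)) measurable_on D"
    by (subst measurable_on_iff_borel_measurable) auto
  then obtain N g where N: "negligible N" and g: "\<And>n. continuous_on UNIV (g n)"
    and lim: "\<And>x. x \<notin> N \<Longrightarrow> (\<lambda>n. g n x) \<longlonglongrightarrow> (if x \<in> D then sgn (w x) else 0)"
    unfolding measurable_on_def by blast
  define h where "h n x = max (- 1) (min 1 (g n x))" for n x
  have h: "continuous_on UNIV (h n)" for n
    unfolding h_def by (intro continuous_intros g)
  have "(\<lambda>n. integral\<^sup>L (lebesgue_on D) (\<lambda>x. w x * h n x)) \<longlonglongrightarrow>
      integral\<^sup>L (lebesgue_on D) (\<lambda>x. \<bar>w x\<bar>)"
  proof (rule integral_dominated_convergence[where w = "\<lambda>x. \<bar>w x\<bar>"])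
    show "(\<lambda>x. w x * h n x) \<in> borel_measurable (lebesgue_on D)" for n
      using integrable_mult_continuous[OF w h] by (rule borel_measurable_integrable)
    have "AE x in lebesgue. x \<notin> N"
      using N by (intro AE_not_in) (simp add: negligible_iff_null_sets)
    then have "AE x in lebesgue_on D. x \<notin> N"
      by (subst AE_restrict_space_iff) auto
    then show "AE x in lebesgue_on D. (\<lambda>n. w x * h n x) \<longlonglongrightarrow> \<bar>w x\<bar>"
    proof (rule AE_mp, intro AE_I2 impI)
      fix x assume x: "x \<in> space (lebesgue_on D)" "x \<notin> N"
      then have "(\<lambda>n. g n x) \<longlonglongrightarrow> sgn (w x)" using lim[of x] by simp
      then have "(\<lambda>n. w x * h n x) \<longlonglongrightarrow> w x * max (- 1) (min 1 (sgn (w x)))"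
        unfolding h_def by (intro tendsto_intros)
      moreover have "w x * max (- 1) (min 1 (sgn (w x))) = \<bar>w x\<bar>"
        by (auto simp: sgn_if)
      ultimately show "(\<lambda>n. w x * h n x) \<longlonglongrightarrow> \<bar>w x\<bar>" by simp
    qed
    show "AE x in lebesgue_on D. norm (w x * h n x) \<le> \<bar>w x\<bar>" for n
      by (intro AE_I2) (auto simp: abs_mult h_def intro!: mult_left_le)
  qed (use w in auto)
  then have "integral\<^sup>L (lebesgue_on D) (\<lambda>x. \<bar>w x\<bar>) = 0"
    by (simp add: cont[OF h] LIMSEQ_const_iff)
  then show ?thesis
    using w by (subst (asm) integral_nonneg_eq_0_iff_AE) auto
qed

section \<open>Expansion of eigenfunctions\<close>

text \<open>
  With the mode as test function in the weak equation, integration by parts in each direction turns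
  the left-hand side into $\sum_i \omega_i^2 = |\omega|^2$ times the integral on the right-hand side.
\<close>

lemma eigenfunction_orthogonal:
  assumes u: "u \<in> L2_on D" "weak_gradient D u Gu"
    and eigen: "\<And>v Gv. v \<in> H1_on D \<Longrightarrow> weak_gradient D v Gv \<Longrightarrow>
      integral\<^sup>L (lebesgue_on D) (\<lambda>x. Gu x \<bullet> Gv x) = \<mu> * integral\<^sup>L (lebesgue_on D) (\<lambda>x. u x * v x)"
    and \<omega>: "admissible \<omega>" "\<omega> \<bullet> \<omega> \<noteq> \<mu>"
  shows "integral\<^sup>L (lebesgue_on D) (\<lambda>x. u x * mode \<omega> x) = 0"
proof -
  have H1: "mode \<omega> \<in> H1_on D"
    using mode_L2 mode_weak_gradient unfolding H1_on_def by blast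
  have int: "integrable (lebesgue_on D) (\<lambda>x. Gu x $ i * partial_deriv i (mode \<omega>) x)" for i
  proof (rule integrable_mult_continuous)
    show "integrable (lebesgue_on D) (\<lambda>x. Gu x $ i)"
      using u(2) by (auto simp: weak_gradient_def intro: L2_integrable)
    show "continuous_on UNIV (partial_deriv i (mode \<omega>))"
      using C_diff_mode[of 1 \<omega>] by simp
  qed
  have "\<mu> * integral\<^sup>L (lebesgue_on D) (\<lambda>x. u x * mode \<omega> x) =
      integral\<^sup>L (lebesgue_on D) (\<lambda>x. \<Sum>i\<in>UNIV. Gu x $ i * partial_deriv i (mode \<omega>) x)"
    using eigen[OF H1 mode_weak_gradient] by (simp add: inner_vec_def)
  also have "\<dots> = (\<Sum>i\<in>UNIV. (\<omega> $ i)\<^sup>2 * integral\<^sup>L (lebesgue_on D) (\<lambda>x. u x * mode \<omega> x))"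
    using int by (simp add: mode_integration_by_parts[OF u \<omega>(1)])
  also have "\<dots> = (\<omega> \<bullet> \<omega>) * integral\<^sup>L (lebesgue_on D) (\<lambda>x. u x * mode \<omega> x)"
    by (simp add: inner_vec_def power2_eq_square sum_distrib_right)
  finally show ?thesis using \<omega>(2) by simp
qed

text \<open>
  Nonnegative frequencies only, since a change of sign in a component does not change the mode.
\<close>

definition spectrum :: "real \<Rightarrow> (real ^ 'n) set" where
  "spectrum \<mu> = {\<omega>. admissible \<omega> \<and> (\<forall>i. \<omega> $ i \<ge> 0) \<and> \<omega> \<bullet> \<omega> = \<mu>}"

text \<open>
  Each component is a multiple of $\pi / (2 a_i)$ and at most $\sqrt\mu$.
\<close>

lemma finite_spectrum: "finite (spectrum \<mu>)"
proof (rule finite_subset)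
  let ?N = "\<lambda>i. \<lfloor>sqrt \<mu> * (2 * a $ i) / pi\<rfloor>"
  show "finite ((\<lambda>f. \<chi> i. f i * pi / (2 * a $ i)) ` (PiE UNIV (\<lambda>i. real_of_int ` {0..?N i})))"
    by (intro finite_imageI finite_PiE) auto
  show "spectrum \<mu> \<subseteq> (\<lambda>f. \<chi> i. f i * pi / (2 * a $ i)) ` (PiE UNIV (\<lambda>i. real_of_int ` {0..?N i}))"
  proof
    fix \<omega> assume \<omega>: "\<omega> \<in> spectrum \<mu>"
    define f where "f i = 2 * \<omega> $ i * a $ i / pi" for i
    have "f i \<in> real_of_int ` {0..?N i}" for i
    proof -
      obtain n :: int where n: "2 * \<omega> $ i * a $ i = of_int n * pi"
        using \<omega> by (auto simp: spectrum_def admissible_def sin_zero_iff_int2)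
      then have f: "f i = of_int n" by (simp add: f_def)
      have "(\<omega> $ i)\<^sup>2 \<le> \<mu>"
        using \<omega> member_le_sum[of i UNIV "\<lambda>i. (\<omega> $ i)\<^sup>2"]
        by (auto simp: spectrum_def inner_vec_def power2_eq_square)
      then have "\<omega> $ i \<le> sqrt \<mu>" by (rule real_le_rsqrt)
      then have "f i \<le> sqrt \<mu> * (2 * a $ i) / pi"
        using a_pos[of i] unfolding f_def by (intro divide_right_mono) (auto simp: mult_ac)
      moreover have "0 \<le> f i"
        using \<omega> a_pos[of i] by (auto simp: f_def spectrum_def less_imp_le)
      ultimately have "n \<in> {0..?N i}" unfolding f by (simp add: le_floor_iff)
      then show ?thesis using f by blast
    qed
    moreover have "\<omega> = (\<chi> i. f i * pi / (2 * a $ i))"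
      using a_pos by (auto simp: vec_eq_iff f_def less_imp_neq[THEN not_sym])
    ultimately show "\<omega> \<in> (\<lambda>f. \<chi> i. f i * pi / (2 * a $ i)) ` (PiE UNIV (\<lambda>i. real_of_int ` {0..?N i}))"
      by (intro image_eqI[of _ _ f]) auto
  qed
qed

lemma nonneg_modes_orthogonal:
  assumes "admissible \<omega>" "admissible \<omega>'" "\<And>i. \<omega> $ i \<ge> 0" "\<And>i. \<omega>' $ i \<ge> 0" "\<omega> \<noteq> \<omega>'"
  shows "integral\<^sup>L (lebesgue_on D) (\<lambda>x. mode \<omega> x * mode \<omega>' x) = 0"
proof -
  obtain i where "\<omega> $ i \<noteq> \<omega>' $ i" using assms(5) by (auto simp: vec_eq_iff)
  then have "(\<omega> $ i)\<^sup>2 \<noteq> (\<omega>' $ i)\<^sup>2" using assms(3,4) by (simp add: power2_eq_iff_nonneg)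
  then show ?thesis using assms modes_orthogonal by blast
qed

lemma mode_abs: "mode (\<chi> i. \<bar>\<omega> $ i\<bar>) = mode \<omega>"
proof -
  have "cos (\<bar>s\<bar> * t) = cos (s * t)" for s t :: real
    by (cases "s \<ge> 0") auto
  then show ?thesis by (simp add: mode_def)
qed

lemma admissible_abs: "admissible \<omega> \<Longrightarrow> admissible (\<chi> i. \<bar>\<omega> $ i\<bar>)"
  by (auto simp: admissible_def abs_if)

lemma integral_mode_sum:
  assumes "finite K"
  shows "integral\<^sup>L (lebesgue_on D) (\<lambda>x. (\<Sum>\<omega>\<in>K. c \<omega> * mode (f \<omega>) x) * mode \<omega>' x) =
    (\<Sum>\<omega>\<in>K. c \<omega> * integral\<^sup>L (lebesgue_on D) (\<lambda>x. mode (f \<omega>) x * mode \<omega>' x))"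
  by (simp add: sum_distrib_right mult.assoc integrable_continuous continuous_mode continuous_on_mult)

text \<open>
  With the Fourier coefficients \<open>c\<close>, the difference of \<open>u\<close> and the sum is orthogonal to all modes.
\<close>

lemma eigenfunction_expansion:
  assumes u: "u \<in> L2_on D"
    and orth: "\<And>\<omega>. admissible \<omega> \<Longrightarrow> \<omega> \<bullet> \<omega> \<noteq> \<mu> \<Longrightarrow> integral\<^sup>L (lebesgue_on D) (\<lambda>x. u x * mode \<omega> x) = 0"
  obtains c where "AE x in lebesgue_on D. u x = (\<Sum>\<omega>\<in>spectrum \<mu>. c \<omega> * mode \<omega> x)"
proof -
  define c where "c \<omega> = integral\<^sup>L (lebesgue_on D) (\<lambda>x. u x * mode \<omega> x) /
    integral\<^sup>L (lebesgue_on D) (\<lambda>x. (mode \<omega> x)\<^sup>2)" for \<omega>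
  let ?U = "\<lambda>x. \<Sum>\<omega>\<in>spectrum \<mu>. c \<omega> * mode \<omega> x"
  have cont: "continuous_on UNIV ?U" by (intro continuous_intros continuous_mode)
  have int: "integrable (lebesgue_on D) u" using u by (rule L2_integrable)
  have orth_U: "integral\<^sup>L (lebesgue_on D) (\<lambda>x. (u x - ?U x) * mode \<omega> x) = 0"
    if \<omega>: "admissible \<omega>" "\<And>i. \<omega> $ i \<ge> 0" for \<omega>
  proof -
    have "integral\<^sup>L (lebesgue_on D) (\<lambda>x. (u x - ?U x) * mode \<omega> x) =
        integral\<^sup>L (lebesgue_on D) (\<lambda>x. u x * mode \<omega> x) - integral\<^sup>L (lebesgue_on D) (\<lambda>x. ?U x * mode \<omega> x)"
      unfolding left_diff_distrib
      by (intro Bochner_Integration.integral_diff integrable_mult_continuous int integrable_continuous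
          cont continuous_mode)
    also have "integral\<^sup>L (lebesgue_on D) (\<lambda>x. ?U x * mode \<omega> x) =
        (\<Sum>\<omega>'\<in>spectrum \<mu>. c \<omega>' * integral\<^sup>L (lebesgue_on D) (\<lambda>x. mode \<omega>' x * mode \<omega> x))"
      by (rule integral_mode_sum) (rule finite_spectrum)
    also have "\<dots> = (\<Sum>\<omega>'\<in>spectrum \<mu>. if \<omega> = \<omega>' then integral\<^sup>L (lebesgue_on D) (\<lambda>x. u x * mode \<omega> x) else 0)"
    proof (rule sum.cong[OF refl])
      fix \<omega>' assume "\<omega>' \<in> spectrum \<mu>"
      then have "admissible \<omega>'" "\<And>i. \<omega>' $ i \<ge> 0" by (auto simp: spectrum_def)
      then show "c \<omega>' * integral\<^sup>L (lebesgue_on D) (\<lambda>x. mode \<omega>' x * mode \<omega> x) =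
          (if \<omega> = \<omega>' then integral\<^sup>L (lebesgue_on D) (\<lambda>x. u x * mode \<omega> x) else 0)"
        using nonneg_modes_orthogonal[of \<omega>' \<omega>] \<omega> mode_norm_pos[of \<omega>]
        by (auto simp: c_def power2_eq_square)
    qed
    also have "\<dots> = integral\<^sup>L (lebesgue_on D) (\<lambda>x. u x * mode \<omega> x)"
      using finite_spectrum orth[of \<omega>] \<omega> by (auto simp: spectrum_def)
    finally show ?thesis by simp
  qed
  have "AE x in lebesgue_on D. u x - ?U x = 0"
  proof (rule modes_complete)
    show "integrable (lebesgue_on D) (\<lambda>x. u x - ?U x)"
      using int integrable_continuous[OF cont] by (rule Bochner_Integration.integrable_diff)
    show "integral\<^sup>L (lebesgue_on D) (\<lambda>x. (u x - ?U x) * mode \<omega> x) = 0" if "admissible \<omega>" for \<omega>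
      using orth_U[OF admissible_abs[OF that]] by (simp add: mode_abs)
  qed
  then show ?thesis using that[of c] by simp
qed

section \<open>Traces on the faces\<close>

text \<open>
  On the face $x_d = -a_d$ the \<open>d\<close>-th factor of every mode is \<open>1\<close>. A mode restricted to this face can
  thus be regarded as the mode on the whole box whose \<open>d\<close>-th frequency is \<open>0\<close>, and integrals over
  the face become integrals over the box.
\<close>

definition drop_axis :: "'n \<Rightarrow> real ^ 'n \<Rightarrow> real ^ 'n" where
  "drop_axis d \<omega> = (\<chi> i. if i = d then 0 else \<omega> $ i)"

definition to_face :: "'n \<Rightarrow> real ^ 'n \<Rightarrow> real ^ 'n" where
  "to_face d x = (\<chi> i. if i = d then - a $ d else x $ i)"

lemma mode_to_face: "mode \<omega> (to_face d x) = mode (drop_axis d \<omega>) x"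
  unfolding mode_def tensor_def by (rule prod.cong) (auto simp: to_face_def drop_axis_def)

lemma to_face_in_frontier:
  assumes "x \<in> D"
  shows "to_face d x \<in> frontier D"
proof -
  have "to_face d x \<in> closure D"
    using assms a_pos by (auto simp: closure_D mem_box_cart to_face_def less_imp_le)
  moreover have "to_face d x \<notin> D"
    by (auto simp: mem_D to_face_def intro: exI[of _ d])
  ultimately show ?thesis using interior_subset[of D] by (auto simp: frontier_def)
qed

lemma admissible_drop_axis: "admissible \<omega> \<Longrightarrow> admissible (drop_axis d \<omega>)"
  by (simp add: admissible_def drop_axis_def)

lemma inner_drop_axis: "\<omega> \<bullet> \<omega> = drop_axis d \<omega> \<bullet> drop_axis d \<omega> + (\<omega> $ d)\<^sup>2"
proof -
  have "(\<Sum>i\<in>UNIV - {d}. drop_axis d \<omega> $ i * drop_axis d \<omega> $ i) = (\<Sum>i\<in>UNIV - {d}. \<omega> $ i * \<omega> $ i)"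
    by (rule sum.cong) (auto simp: drop_axis_def)
  then show ?thesis
    by (simp add: inner_vec_def sum.remove[of UNIV d] power2_eq_square) (simp add: drop_axis_def)
qed

text \<open>
  The lost component is recovered from $\omega_d^2 = \mu - \sum_{i \ne d} \omega_i^2$ and its sign.
\<close>

lemma inj_on_drop_axis: "inj_on (drop_axis d) (spectrum \<mu>)"
proof (rule inj_onI)
  fix \<omega> \<omega>' assume h: "\<omega> \<in> spectrum \<mu>" "\<omega>' \<in> spectrum \<mu>" and eq: "drop_axis d \<omega> = drop_axis d \<omega>'"
  have "(\<omega> $ d)\<^sup>2 = (\<omega>' $ d)\<^sup>2"
  proof -
    have "\<omega> \<bullet> \<omega> = \<mu>" "\<omega>' \<bullet> \<omega>' = \<mu>" using h by (auto simp: spectrum_def)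
    then show ?thesis
      using inner_drop_axis[of \<omega> d] inner_drop_axis[of \<omega>' d] unfolding eq by linarith
  qed
  then have d: "\<omega> $ d = \<omega>' $ d" by (rule power2_eq_imp_eq) (use h in \<open>auto simp: spectrum_def\<close>)
  show "\<omega> = \<omega>'"
  proof (rule vec_eq_iff[THEN iffD2], rule allI)
    fix i
    show "\<omega> $ i = \<omega>' $ i"
      using d arg_cong[OF eq, of "\<lambda>v. v $ i"] by (cases "i = d") (auto simp: drop_axis_def)
  qed
qed

definition face_trace :: "real \<Rightarrow> (real ^ 'n \<Rightarrow> real) \<Rightarrow> 'n \<Rightarrow> real ^ 'n \<Rightarrow> real" where
  "face_trace \<mu> c d x = (\<Sum>\<omega>\<in>spectrum \<mu>. c \<omega> * mode (drop_axis d \<omega>) x)"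

lemma continuous_face_trace: "continuous_on UNIV (face_trace \<mu> c d)"
  unfolding face_trace_def[abs_def] by (intro continuous_intros continuous_mode)

text \<open>
  Since the truncated frequencies are still different from each other, the trace is again an
  orthogonal expansion.
\<close>

lemma face_trace_coefficient:
  assumes "\<omega> \<in> spectrum \<mu>"
  shows "integral\<^sup>L (lebesgue_on D) (\<lambda>x. face_trace \<mu> c d x * mode (drop_axis d \<omega>) x) =
    c \<omega> * integral\<^sup>L (lebesgue_on D) (\<lambda>x. (mode (drop_axis d \<omega>) x)\<^sup>2)"
proof -
  have "integral\<^sup>L (lebesgue_on D) (\<lambda>x. face_trace \<mu> c d x * mode (drop_axis d \<omega>) x) =
      (\<Sum>\<omega>'\<in>spectrum \<mu>. c \<omega>' * integral\<^sup>L (lebesgue_on D) (\<lambda>x. mode (drop_axis d \<omega>') x * mode (drop_axis d \<omega>) x))"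
    unfolding face_trace_def by (rule integral_mode_sum) (rule finite_spectrum)
  also have "\<dots> = (\<Sum>\<omega>'\<in>spectrum \<mu>. if \<omega> = \<omega>' then c \<omega> * integral\<^sup>L (lebesgue_on D) (\<lambda>x. (mode (drop_axis d \<omega>) x)\<^sup>2) else 0)"
  proof (rule sum.cong[OF refl])
    fix \<omega>' assume \<omega>': "\<omega>' \<in> spectrum \<mu>"
    show "c \<omega>' * integral\<^sup>L (lebesgue_on D) (\<lambda>x. mode (drop_axis d \<omega>') x * mode (drop_axis d \<omega>) x) =
        (if \<omega> = \<omega>' then c \<omega> * integral\<^sup>L (lebesgue_on D) (\<lambda>x. (mode (drop_axis d \<omega>) x)\<^sup>2) else 0)"
    proof (cases "\<omega> = \<omega>'")
      case False
      then have "drop_axis d \<omega>' \<noteq> drop_axis d \<omega>"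
        using inj_onD[OF inj_on_drop_axis[of d \<mu>] _ \<omega>' assms] by blast
      then have "integral\<^sup>L (lebesgue_on D) (\<lambda>x. mode (drop_axis d \<omega>') x * mode (drop_axis d \<omega>) x) = 0"
        using assms \<omega>'
        by (intro nonneg_modes_orthogonal admissible_drop_axis) (auto simp: spectrum_def drop_axis_def)
      then show ?thesis using False by simp
    qed (simp add: power2_eq_square)
  qed
  also have "\<dots> = c \<omega> * integral\<^sup>L (lebesgue_on D) (\<lambda>x. (mode (drop_axis d \<omega>) x)\<^sup>2)"
    using assms finite_spectrum by simp
  finally show ?thesis .
qed

lemma face_trace_orthogonal:
  assumes "admissible \<omega>'" "\<And>i. \<omega>' $ i \<ge> 0" "\<omega>' \<notin> drop_axis d ` spectrum \<mu>"
  shows "integral\<^sup>L (lebesgue_on D) (\<lambda>x. face_trace \<mu> c d x * mode \<omega>' x) = 0"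
proof -
  have "integral\<^sup>L (lebesgue_on D) (\<lambda>x. face_trace \<mu> c d x * mode \<omega>' x) =
      (\<Sum>\<omega>\<in>spectrum \<mu>. c \<omega> * integral\<^sup>L (lebesgue_on D) (\<lambda>x. mode (drop_axis d \<omega>) x * mode \<omega>' x))"
    unfolding face_trace_def by (rule integral_mode_sum) (rule finite_spectrum)
  also have "\<dots> = 0"
  proof (intro sum.neutral ballI)
    fix \<omega> assume "\<omega> \<in> spectrum \<mu>"
    then have "integral\<^sup>L (lebesgue_on D) (\<lambda>x. mode (drop_axis d \<omega>) x * mode \<omega>' x) = 0"
      using assms
      by (intro nonneg_modes_orthogonal admissible_drop_axis) (auto simp: spectrum_def drop_axis_def)
    then show "c \<omega> * integral\<^sup>L (lebesgue_on D) (\<lambda>x. mode (drop_axis d \<omega>) x * mode \<omega>' x) = 0" by simp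
  qed
  finally show ?thesis .
qed

end

section \<open>Testing the trace on a face\<close>

lemma eventually_cos_neq_1:
  assumes "\<rho> > (0::real)"
  shows "\<forall>\<^sub>F t in at_right 0. cos (\<rho> * (y + t)) \<noteq> 1"
proof -
  define n where "n = \<lfloor>\<rho> * y / (2 * pi)\<rfloor>"
  have "of_int n \<le> \<rho> * y / (2 * pi)" "\<rho> * y / (2 * pi) < of_int n + 1"
    using floor_correct[of "\<rho> * y / (2 * pi)"] unfolding n_def by auto
  then have n: "of_int n * (2 * pi) \<le> \<rho> * y" "\<rho> * y < (of_int n + 1) * (2 * pi)"
    by (simp_all only: pos_le_divide_eq pos_divide_less_eq pi_gt_zero mult_pos_pos zero_less_numeral)
  have "((\<lambda>t. \<rho> * (y + t)) \<longlongrightarrow> \<rho> * (y + 0)) (at_right 0)"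
    by (intro tendsto_intros)
  then have "\<forall>\<^sub>F t in at_right 0. \<rho> * (y + t) < (of_int n + 1) * (2 * pi)"
    using n(2) by (intro order_tendstoD(2)) auto
  moreover have "\<forall>\<^sub>F t in at_right 0. (0::real) < t"
    by (rule eventually_at_right_less)
  ultimately show ?thesis
  proof eventually_elim
    case (elim t)
    have "of_int n * (2 * pi) < \<rho> * (y + t)"
      using n(1) mult_pos_pos[OF assms elim(2)] by (simp add: distrib_left)
    show ?case
    proof
      assume "cos (\<rho> * (y + t)) = 1"
      then obtain m :: int where m: "\<rho> * (y + t) = of_int m * (2 * pi)"
        by (auto simp: cos_one_2pi_int)
      then have "real_of_int n < of_int m" "real_of_int m < of_int (n + 1)"
        using elim(1) \<open>of_int n * (2 * pi) < \<rho> * (y + t)\<close> by auto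
      then show False unfolding of_int_less_iff by linarith
    qed
  qed
qed

context neumann_box
begin

definition axis_test :: "real \<Rightarrow> 'n set \<Rightarrow> real ^ 'n \<Rightarrow> real" where
  "axis_test \<rho> S x = (\<Prod>i\<in>S. 1 - cos (\<rho> * (x $ i + a $ i)))"

definition subset_frequency :: "real \<Rightarrow> 'n set \<Rightarrow> real ^ 'n" where
  "subset_frequency \<rho> T = (\<chi> i. if i \<in> T then \<rho> else 0)"

lemma axis_test_expansion:
  "axis_test \<rho> S x = (\<Sum>T\<in>Pow S. (- 1) ^ card T * mode (subset_frequency \<rho> T) x)"
proof -
  have T: "mode (subset_frequency \<rho> T) x = (\<Prod>i\<in>T. cos (\<rho> * (x $ i + a $ i)))" for T
    unfolding mode_def tensor_def
    by (rule prod.mono_neutral_cong_right) (auto simp: subset_frequency_def)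
  have "axis_test \<rho> S x = (\<Prod>i\<in>S. - cos (\<rho> * (x $ i + a $ i)) + 1)"
    by (simp add: axis_test_def)
  also have "\<dots> = (\<Sum>T\<in>Pow S. \<Prod>i\<in>T. - cos (\<rho> * (x $ i + a $ i)))"
    by (subst prod_add) auto
  finally show ?thesis by (simp add: T prod_uminus)
qed

lemma continuous_axis_test: "continuous_on UNIV (axis_test \<rho> S)"
  unfolding axis_test_def[abs_def] by (intro continuous_intros)

lemma axis_test_nonneg: "axis_test \<rho> S x \<ge> 0"
  unfolding axis_test_def by (rule prod_nonneg) simp

text \<open>
  Where the test function vanishes, it becomes positive after a small shift in the diagonal
  direction. So an open set on which \<open>V\<close> is positive contains points where the product is positive.
\<close>

lemma axis_test_integral_pos:
  assumes "\<rho> > 0" "continuous_on UNIV V" "\<And>x. x \<in> D \<Longrightarrow> V x \<ge> 0" "x \<in> D" "V x \<noteq> (0::real)"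
  shows "integral\<^sup>L (lebesgue_on D) (\<lambda>x. V x * axis_test \<rho> S x) > 0"
proof -
  have "integral\<^sup>L (lebesgue_on D) (\<lambda>x. V x * axis_test \<rho> S x) \<noteq> 0"
  proof
    assume "integral\<^sup>L (lebesgue_on D) (\<lambda>x. V x * axis_test \<rho> S x) = 0"
    then have zero: "V y * axis_test \<rho> S y = 0" if "y \<in> D" for y
      using assms(2,3) axis_test_nonneg closure_subset[of D] that
      by (intro continuous_nonneg_integral_eq_0[of "\<lambda>x. V x * axis_test \<rho> S x"]
          continuous_on_mult continuous_axis_test) auto
    define p where "p t = x + t *\<^sub>R (\<chi> i. 1)" for t
    have p: "(p \<longlongrightarrow> x + 0 *\<^sub>R (\<chi> i. 1)) (at_right 0)"
      unfolding p_def by (intro tendsto_intros)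
    then have p: "(p \<longlongrightarrow> x) (at_right 0)" by simp
    have "isCont V x" using assms(2) by (simp add: continuous_on_eq_continuous_at)
    then have "((\<lambda>t. V (p t)) \<longlongrightarrow> V x) (at_right 0)"
      using p by (rule isCont_tendsto_compose)
    then have "\<forall>\<^sub>F t in at_right 0. V (p t) \<noteq> 0"
      using assms(5) by (rule tendsto_imp_eventually_ne)
    moreover have "\<forall>\<^sub>F t in at_right 0. p t \<in> D"
      using p open_box assms(4) by (rule topological_tendstoD)
    moreover have "\<forall>\<^sub>F t in at_right 0. \<forall>i\<in>S. cos (\<rho> * (x $ i + a $ i + t)) \<noteq> 1"
      using eventually_cos_neq_1[OF assms(1)] by (intro eventually_ball_finite) auto
    ultimately have "\<forall>\<^sub>F t in at_right (0::real). False"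
    proof eventually_elim
      case (elim t)
      have "axis_test \<rho> S (p t) \<noteq> 0"
        using elim(3) by (auto simp: axis_test_def p_def algebra_simps)
      then show ?case using zero[OF elim(2)] elim(1) by simp
    qed
    then show False by simp
  qed
  moreover have "integral\<^sup>L (lebesgue_on D) (\<lambda>x. V x * axis_test \<rho> S x) \<ge> 0"
    using assms(3) axis_test_nonneg by (intro Bochner_Integration.integral_nonneg) simp
  ultimately show ?thesis by linarith
qed

text \<open>
  The coefficients $b_i$ of the modes depending on one coordinate only.
\<close>

definition axis_coeff :: "real \<Rightarrow> (real ^ 'n \<Rightarrow> real) \<Rightarrow> 'n \<Rightarrow> real" where
  "axis_coeff \<mu> c i = (if axis i (sqrt \<mu>) \<in> spectrum \<mu> then c (axis i (sqrt \<mu>)) else 0)"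

lemma axis_in_spectrum_iff:
  assumes "\<mu> > 0"
  shows "axis i (sqrt \<mu>) \<in> spectrum \<mu> \<longleftrightarrow> sin (2 * sqrt \<mu> * a $ i) = 0"
proof -
  have "axis i (sqrt \<mu>) \<bullet> axis i (sqrt \<mu>) = \<mu>" "axis i (sqrt \<mu>) $ j \<ge> 0" for j
    using assms by (auto simp: inner_axis_axis) (simp add: axis_def)
  moreover have "admissible (axis i (sqrt \<mu>)) \<Longrightarrow> sin (2 * sqrt \<mu> * a $ i) = 0"
    by (auto simp: admissible_def axis_def dest: spec[of _ i])
  ultimately show ?thesis
    using admissible_axis by (auto simp: spectrum_def)
qed

lemma measure_D_pos: "measure lebesgue D > 0"
  using mode_norm_pos[of 0] by (simp add: mode_zero measure_restrict_space)

text \<open>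
  The square of $\cos s$ is $\frac12 + \frac12 \cos 2s$, and the second term has mean zero.
\<close>

lemma integral_axis_mode_square:
  assumes "\<rho> > 0" "sin (2 * \<rho> * a $ i) = 0"
  shows "integral\<^sup>L (lebesgue_on D) (\<lambda>x. (mode (axis i \<rho>) x)\<^sup>2) = measure lebesgue D / 2"
proof -
  have sq: "(mode (axis i \<rho>) x)\<^sup>2 = mode (axis i (2 * \<rho>)) x / 2 + 1 / 2" for x
    by (simp add: mode_axis cos_double_cos mult.assoc diff_divide_distrib)
  have "admissible (axis i \<rho>)" using assms(2) by (rule admissible_axis)
  then have "admissible (axis i \<rho> + axis i \<rho>)" by (intro admissible_add)
  also have "axis i \<rho> + axis i \<rho> = axis i (2 * \<rho>)" by (simp add: vec_eq_iff axis_def)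
  finally have "integral\<^sup>L (lebesgue_on D) (\<lambda>x. mode (axis i (2 * \<rho>)) x * mode 0 x) = 0"
    using assms(1) by (intro modes_orthogonal[of _ _ i] admissible_zero) (auto simp: axis_def)
  then have "integral\<^sup>L (lebesgue_on D) (mode (axis i (2 * \<rho>))) = 0"
    by (simp add: mode_zero)
  then show ?thesis
    unfolding sq using integrable_continuous[OF continuous_mode, of "axis i (2 * \<rho>)"]
    by (simp add: measure_restrict_space)
qed

text \<open>
  A frequency of the spectrum that is truncated to \<open>0\<close> lies on the axis \<open>d\<close>.
\<close>

lemma face_trace_mean:
  assumes "\<mu> > 0"
  shows "integral\<^sup>L (lebesgue_on D) (\<lambda>x. face_trace \<mu> c d x * mode 0 x) = axis_coeff \<mu> c d * measure lebesgue D"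
proof (cases "axis d (sqrt \<mu>) \<in> spectrum \<mu>")
  case True
  moreover have "drop_axis d (axis d (sqrt \<mu>)) = 0" by (simp add: vec_eq_iff drop_axis_def axis_def)
  ultimately show ?thesis
    using face_trace_coefficient[OF True, of c d]
    by (simp add: axis_coeff_def mode_zero measure_restrict_space)
next
  case False
  have "0 \<notin> drop_axis d ` spectrum \<mu>"
  proof
    assume "0 \<in> drop_axis d ` spectrum \<mu>"
    then obtain \<omega> where \<omega>: "\<omega> \<in> spectrum \<mu>" "drop_axis d \<omega> = 0" by auto
    then have "(\<omega> $ d)\<^sup>2 = \<mu>" using inner_drop_axis[of \<omega> d] by (simp add: spectrum_def)
    then have "\<omega> $ d = sqrt \<mu>" using \<omega>(1) by (auto simp: spectrum_def)
    then have "\<omega> = axis d (sqrt \<mu>)"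
      using \<omega>(2) by (auto simp: vec_eq_iff drop_axis_def axis_def split: if_splits)
    then show False using \<omega>(1) False by simp
  qed
  then show ?thesis
    using False face_trace_orthogonal[OF admissible_zero, of d \<mu> c] by (simp add: axis_coeff_def)
qed

lemma face_trace_axis:
  assumes "\<mu> > 0" "sin (2 * sqrt \<mu> * a $ i) = 0" "i \<noteq> d"
  shows "integral\<^sup>L (lebesgue_on D) (\<lambda>x. face_trace \<mu> c d x * mode (axis i (sqrt \<mu>)) x) =
    axis_coeff \<mu> c i * measure lebesgue D / 2"
proof -
  have mem: "axis i (sqrt \<mu>) \<in> spectrum \<mu>" using assms axis_in_spectrum_iff by simp
  have "drop_axis d (axis i (sqrt \<mu>)) = axis i (sqrt \<mu>)"
    using assms(3) by (auto simp: vec_eq_iff drop_axis_def axis_def)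
  then show ?thesis
    using face_trace_coefficient[OF mem, of c d] integral_axis_mode_square[of "sqrt \<mu>" i] assms mem
    by (simp add: axis_coeff_def)
qed

text \<open>
  The frequencies in the trace satisfy $|\omega'|^2 \le \mu$, while the test mode has
  $|\omega'|^2 = (\mathrm{card}\, T)\, \mu \ge 2 \mu$.
\<close>

lemma face_trace_high_frequency:
  assumes "\<mu> > 0" "card T \<ge> 2" "\<And>i. i \<in> T \<Longrightarrow> sin (2 * sqrt \<mu> * a $ i) = 0"
  shows "integral\<^sup>L (lebesgue_on D) (\<lambda>x. face_trace \<mu> c d x * mode (subset_frequency (sqrt \<mu>) T) x) = 0"
proof (rule face_trace_orthogonal)
  show "admissible (subset_frequency (sqrt \<mu>) T)"
    using assms(3) by (simp add: admissible_def subset_frequency_def)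
  show "subset_frequency (sqrt \<mu>) T $ i \<ge> 0" for i
    using assms(1) by (simp add: subset_frequency_def)
  show "subset_frequency (sqrt \<mu>) T \<notin> drop_axis d ` spectrum \<mu>"
  proof
    assume "subset_frequency (sqrt \<mu>) T \<in> drop_axis d ` spectrum \<mu>"
    then obtain \<omega> where \<omega>: "\<omega> \<in> spectrum \<mu>" "subset_frequency (sqrt \<mu>) T = drop_axis d \<omega>" by auto
    have "subset_frequency (sqrt \<mu>) T \<bullet> subset_frequency (sqrt \<mu>) T = (\<Sum>i\<in>UNIV. if i \<in> T then \<mu> else 0)"
      unfolding inner_vec_def using assms(1) by (intro sum.cong) (auto simp: subset_frequency_def)
    also have "\<dots> = card T * \<mu>"
      by (simp add: sum.If_cases)
    finally have "drop_axis d \<omega> \<bullet> drop_axis d \<omega> = card T * \<mu>" unfolding \<omega>(2) .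
    moreover have "\<omega> \<bullet> \<omega> = \<mu>" using \<omega>(1) by (simp add: spectrum_def)
    ultimately have "card T * \<mu> \<le> \<mu>"
      using inner_drop_axis[of \<omega> d] zero_le_power2[of "\<omega> $ d"] by linarith
    moreover have "2 * \<mu> \<le> card T * \<mu>"
      using assms by (intro mult_right_mono) auto
    ultimately show False using assms(1) by simp
  qed
qed

text \<open>
  In the expansion of the integral of the trace against \<open>axis_test\<close>, only the empty set and the
  singletons contribute. The factor one half is the mean of a squared cosine, in contrast to
  the mean \<open>1\<close> of the constant mode.
\<close>

lemma axis_coeff_inequality:
  assumes \<mu>: "\<mu> > 0" and nonneg: "\<And>x. x \<in> D \<Longrightarrow> face_trace \<mu> c d x \<ge> 0"
    and c: "\<omega> \<in> spectrum \<mu>" "c \<omega> \<noteq> 0"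
  shows "axis_coeff \<mu> c d \<ge> 0" "axis_coeff \<mu> c d > (\<Sum>i\<in>UNIV - {d}. axis_coeff \<mu> c i) / 2"
proof -
  let ?V = "face_trace \<mu> c d"
  define \<rho> where "\<rho> = sqrt \<mu>"
  define m where "m = measure lebesgue D"
  have m: "m > 0" unfolding m_def by (rule measure_D_pos)
  have "0 \<le> integral\<^sup>L (lebesgue_on D) (\<lambda>x. ?V x * mode 0 x)"
    using nonneg by (intro Bochner_Integration.integral_nonneg) (simp add: mode_zero)
  then show "axis_coeff \<mu> c d \<ge> 0"
    using m unfolding face_trace_mean[OF \<mu>] m_def by (simp add: zero_le_mult_iff)
  define S where "S = {i. i \<noteq> d \<and> sin (2 * \<rho> * a $ i) = 0}"
  obtain x where x: "x \<in> D" "?V x \<noteq> 0"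
  proof (rule ccontr)
    assume "\<not> thesis"
    then have "?V x = 0" if "x \<in> D" for x using that \<open>\<And>x. x \<in> D \<Longrightarrow> ?V x \<noteq> 0 \<Longrightarrow> thesis\<close> by blast
    then have "integral\<^sup>L (lebesgue_on D) (\<lambda>x. ?V x * mode (drop_axis d \<omega>) x) = integral\<^sup>L (lebesgue_on D) (\<lambda>x. 0)"
      by (intro Bochner_Integration.integral_cong) auto
    then show False
      using face_trace_coefficient[OF c(1), of c d] c(2) mode_norm_pos[of "drop_axis d \<omega>"] by simp
  qed
  define I where "I T = integral\<^sup>L (lebesgue_on D) (\<lambda>x. ?V x * mode (subset_frequency \<rho> T) x)" for T
  have expand: "?V x * axis_test \<rho> S x = (\<Sum>T\<in>Pow S. (- 1) ^ card T * (?V x * mode (subset_frequency \<rho> T) x))" for x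
    by (simp add: axis_test_expansion sum_distrib_left mult.left_commute)
  have "0 < integral\<^sup>L (lebesgue_on D) (\<lambda>x. ?V x * axis_test \<rho> S x)"
    using \<mu> nonneg x by (intro axis_test_integral_pos[OF _ continuous_face_trace]) (auto simp: \<rho>_def)
  also have "\<dots> = (\<Sum>T\<in>Pow S. (- 1) ^ card T * I T)"
    unfolding expand I_def
    by (simp add: integrable_continuous continuous_on_mult continuous_face_trace continuous_mode)
  also have "\<dots> = (\<Sum>T\<in>insert {} ((\<lambda>i. {i}) ` S). (- 1) ^ card T * I T)"
  proof (rule sum.mono_neutral_right)
    show "\<forall>T\<in>Pow S - insert {} ((\<lambda>i. {i}) ` S). (- 1) ^ card T * I T = 0"
    proof
      fix T assume T: "T \<in> Pow S - insert {} ((\<lambda>i. {i}) ` S)"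
      then have "card T \<noteq> 0" "card T \<noteq> 1"
        by (auto simp: card_1_singleton_iff)
      then have "card T \<ge> 2" by linarith
      then have "I T = 0"
        unfolding I_def \<rho>_def using T by (intro face_trace_high_frequency[OF \<mu>]) (auto simp: S_def \<rho>_def)
      then show "(- 1) ^ card T * I T = 0" by simp
    qed
  qed auto
  also have "\<dots> = I {} - (\<Sum>i\<in>S. I {i})"
    by (subst sum.insert) (auto simp: sum.reindex sum_negf)
  also have "I {} = axis_coeff \<mu> c d * m"
  proof -
    have "subset_frequency \<rho> {} = 0" by (simp add: subset_frequency_def vec_eq_iff)
    then show ?thesis using face_trace_mean[OF \<mu>, of c d] by (simp add: I_def m_def)
  qed
  also have "(\<Sum>i\<in>S. I {i}) = (\<Sum>i\<in>S. axis_coeff \<mu> c i * m / 2)"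
  proof (rule sum.cong[OF refl])
    fix i assume "i \<in> S"
    moreover have "subset_frequency \<rho> {i} = axis i \<rho>"
      by (auto simp: subset_frequency_def vec_eq_iff axis_def)
    ultimately show "I {i} = axis_coeff \<mu> c i * m / 2"
      using face_trace_axis[OF \<mu>, of i d c] by (simp add: I_def m_def S_def \<rho>_def)
  qed
  also have "\<dots> = (\<Sum>i\<in>UNIV - {d}. axis_coeff \<mu> c i * m / 2)"
    by (rule sum.mono_neutral_left) (auto simp: S_def \<rho>_def axis_coeff_def axis_in_spectrum_iff[OF \<mu>])
  finally have "0 < m * (axis_coeff \<mu> c d - (\<Sum>i\<in>UNIV - {d}. axis_coeff \<mu> c i) / 2)"
    by (simp add: right_diff_distrib sum_distrib_left sum_divide_distrib mult.commute)
  then show "axis_coeff \<mu> c d > (\<Sum>i\<in>UNIV - {d}. axis_coeff \<mu> c i) / 2"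
    using m by (simp add: zero_less_mult_iff)
qed

text \<open>
  Summing $b_d > \frac12 (B - b_d)$ over all axes gives $B > \frac12 (n - 1) B \ge B$.
\<close>

lemma no_nonneg_face_traces:
  assumes "CARD('n) > 2" "\<mu> > 0" "\<omega> \<in> spectrum \<mu>" "c \<omega> \<noteq> 0"
  shows "\<exists>d. \<exists>x\<in>D. face_trace \<mu> c d x < 0"
proof (rule ccontr)
  assume "\<not> ?thesis"
  then have nonneg: "\<And>d x. x \<in> D \<Longrightarrow> face_trace \<mu> c d x \<ge> 0" by (meson not_less)
  let ?b = "axis_coeff \<mu> c"
  define B where "B = sum ?b UNIV"
  have "?b d \<ge> 0" and strict: "?b d > (\<Sum>i\<in>UNIV - {d}. ?b i) / 2" for d
    using axis_coeff_inequality[OF assms(2) nonneg assms(3,4)] by auto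
  then have B: "B \<ge> 0" by (simp add: B_def sum_nonneg)
  have "(\<Sum>d\<in>UNIV. (B - ?b d) / 2) < (\<Sum>d\<in>UNIV. ?b d)"
  proof (rule sum_strict_mono)
    fix d
    have "(\<Sum>i\<in>UNIV - {d}. ?b i) = B - ?b d" by (simp add: B_def sum_diff1)
    then show "(B - ?b d) / 2 < ?b d" using strict[of d] by simp
  qed auto
  then have "(real CARD('n) * B - B) / 2 < B"
    by (simp add: sum_subtractf B_def flip: sum_divide_distrib)
  moreover have "3 * B \<le> real CARD('n) * B"
    using assms(1) B by (intro mult_right_mono) auto
  ultimately show False using B by simp
qed

end

theorem theorem1p4:
  fixes a :: "real ^ 'n::finite" and u :: "real ^ 'n \<Rightarrow> real"
  assumes "CARD('n) > 2"
    and "\<forall>i. a $ i > 0"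
    and "neumann_eigenfunction (box (- a) a) u"
    and "\<forall>x\<in>frontier (box (- a) a). extension (box (- a) a) u x \<ge> 0"
  shows "\<exists>c. AE x in lebesgue_on (box (- a) a). u x = c"
proof -
  interpret neumann_box a using assms(2) by unfold_locales simp
  obtain \<mu> Gu where u: "u \<in> L2_on D" "weak_gradient D u Gu"
    and eigen: "\<And>v Gv. v \<in> H1_on D \<Longrightarrow> weak_gradient D v Gv \<Longrightarrow>
      integral\<^sup>L (lebesgue_on D) (\<lambda>x. Gu x \<bullet> Gv x) = \<mu> * integral\<^sup>L (lebesgue_on D) (\<lambda>x. u x * v x)"
    using assms(3) unfolding neumann_eigenfunction_def H1_on_def by blast
  obtain c where c: "AE x in lebesgue_on D. u x = (\<Sum>\<omega>\<in>spectrum \<mu>. c \<omega> * mode \<omega> x)"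
    using eigenfunction_expansion[OF u(1) eigenfunction_orthogonal[OF u eigen]] by blast
  let ?U = "\<lambda>x. \<Sum>\<omega>\<in>spectrum \<mu>. c \<omega> * mode \<omega> x"
  show ?thesis
  proof (cases "\<mu> > 0")
    case False
    have "spectrum \<mu> \<subseteq> {0}"
    proof
      fix \<omega> assume "\<omega> \<in> spectrum \<mu>"
      then have "\<not> 0 < \<omega> \<bullet> \<omega>" using False by (simp add: spectrum_def)
      then show "\<omega> \<in> {0}" unfolding inner_gt_zero_iff by simp
    qed
    then consider "spectrum \<mu> = {}" | "spectrum \<mu> = {0}" by blast
    then show ?thesis
    proof cases
      case 1
      then have "AE x in lebesgue_on D. u x = 0" using c by simp
      then show ?thesis by (rule exI)
    next
      case 2
      then have "AE x in lebesgue_on D. u x = c 0" using c by (simp add: mode_zero)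
      then show ?thesis by (rule exI)
    qed
  next
    case True
    have "\<exists>\<omega>\<in>spectrum \<mu>. c \<omega> \<noteq> 0"
    proof (rule ccontr)
      assume "\<not> ?thesis"
      then have "AE x in lebesgue_on D. u x = 0" using c by simp
      then show False using assms(3) by (simp add: neumann_eigenfunction_def)
    qed
    then obtain d x where x: "x \<in> D" "face_trace \<mu> c d x < 0"
      using no_nonneg_face_traces[OF assms(1) True] by blast
    have U: "continuous_extension D u ?U"
      unfolding continuous_extension_def
      using c by (auto intro!: continuous_intros continuous_mode elim: AE_mp)
    then have "continuous_extension D u (extension D u)"
      unfolding extension_def by (rule someI[of "continuous_extension D u"])
    moreover have "to_face d x \<in> closure D"
      using to_face_in_frontier[OF x(1)] by (simp add: frontier_def)
    ultimately have "extension D u (to_face d x) = ?U (to_face d x)"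
      using U by (intro continuous_extension_unique[of D u]) auto
    also have "\<dots> = face_trace \<mu> c d x"
      by (simp add: mode_to_face face_trace_def)
    finally have "extension D u (to_face d x) < 0" using x(2) by simp
    moreover have "extension D u (to_face d x) \<ge> 0"
      using assms(4) to_face_in_frontier[OF x(1)] by (rule bspec)
    ultimately show ?thesis by linarith
  qed
qed

end
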